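(* Let $p\ge 1$ and $k\ge 1$ be integers and let $\alpha_1,\dots,\alpha_k,\zeta_1,\dots,\zeta_k$ be complex numbers with $\Re(\alpha_j)>\frac{p-1}{2}$ and $\Re(\zeta_j)>\frac{p-1}{2}$ for $j=1,\dots,k$. Let $X_1,\dots,X_k$ be mutually independently distributed real $p\times p$ matrix-variate type-1 beta random matrices, $X_j$ having density $$\frac{\Gamma_p(\zeta_j+\alpha_j)}{\Gamma_p(\zeta_j)\Gamma_p(\alpha_j)}|X_j|^{\zeta_j-\frac{p+1}{2}}|I-X_j|^{\alpha_j-\frac{p+1}{2}},\quad O<X_j<I,$$ and zero elsewhere. Let $V_1,\dots,V_k$ be real $p\times p$ positive definite random matrices having a joint density $f(V_1,\dots,V_k)$, and let the sets $(X_1,\dots,X_k)$ and $(V_1,\dots,V_k)$ be independently distributed. Define $U_1,\dots,U_k$ by $X_j=V_j^{1/2}U_j^{-1}V_j^{1/2}$, $j=1,\dots,k$, and let $g(U_1,\dots,U_k)$ be the joint density of $U_1,\dots,U_k$. Then $$\Big\{\prod_{j=1}^k\frac{\Gamma_p(\zeta_j)}{\Gamma_p(\zeta_j+\alpha_j)}\Big\}g(U_1,\dots,U_k)=I_{U_1,\dots,U_k}^{(\zeta_j,\alpha_j),j=1,\dots,k}f(U_1,\dots,U_k),$$ where $$I_{U_1,\dots,U_k}^{(\zeta_j,\alpha_j),j=1,\dots,k}f(U_1,\dots,U_k)=\Big\{\prod_{j=1}^k\frac{|U_j|^{-\zeta_j-\alpha_j}}{\Gamma_p(\alpha_j)}\int_{O<V_j<U_j}|V_j|^{\zeta_j}|U_j-V_j|^{\alpha_j-\frac{p+1}{2}}\Big\}f(V_1,\dots,V_k)\,{\rm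 d}V_1\wedge\cdots\wedge{\rm d}V_k .$$
   Context: All matrices are real symmetric $p\times p$; $X>O$ means $X$ is positive definite, $A<B$ means $B-A>O$, and $O<X<I$ means all eigenvalues of $X$ lie in $(0,1)$. $|X|$ is the determinant, $X^{1/2}$ the positive definite square root, and ${\rm d}X$ the wedge product of the differentials $dx_{ij}$, $i\ge j$. The real matrix-variate gamma function is $\Gamma_p(\alpha)=\pi^{p(p-1)/4}\Gamma(\alpha)\Gamma(\alpha-\frac12)\cdots\Gamma(\alpha-\frac{p-1}{2})$ for $\Re(\alpha)>\frac{p-1}{2}$. The operator $I_{U_1,\dots,U_k}^{(\zeta_j,\alpha_j),j=1,\dots,k}$ is the paper's (generalized Kober) fractional integral operator of the first kind of orders $\alpha_1,\dots,\alpha_k$ in many matrix variables. *)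

theory Defs
  imports "HOL-Probability.Probability"
begin

text \<open>Real p x p matrices are modelled as real^'p^'p, where 'p is a finite
linearly ordered index type with CARD('p) = p (so p >= 1 automatically).\<close>

definition symmetric_mat :: "real^'p::finite^'p \<Rightarrow> bool" where
  "symmetric_mat A \<longleftrightarrow> transpose A = A"

definition posdef :: "real^'p::finite^'p \<Rightarrow> bool" where
  "posdef A \<longleftrightarrow> symmetric_mat A \<and> (\<forall>x::real^'p. x \<noteq> 0 \<longrightarrow> x \<bullet> (A *v x) > 0)"

definition mat_less :: "real^'p::finite^'p \<Rightarrow> real^'p^'p \<Rightarrow> bool" where
  "mat_less A B \<longleftrightarrow> posdef (B - A)"

definition msqrt :: "real^'p::finite^'p \<Rightarrow> real^'p^'p" where
  "msqrt A = (THE B. posdef B \<and> B ** B = A)"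

text \<open>Lebesgue measure dX = wedge of dx_ij, i >= j, on symmetric matrices:
image of Lebesgue measure on the lower-triangular coordinates.\<close>
definition lower_idx :: "('p::linorder \<times> 'p) set" where
  "lower_idx = {(i, j). j \<le> i}"

definition sym_of :: "('p::{finite,linorder} \<times> 'p::{finite,linorder} \<Rightarrow> real) \<Rightarrow> real^'p::{finite,linorder}^'p::{finite,linorder}" where
  "sym_of x = (\<chi> i j. if j \<le> i then x (i, j) else x (j, i))"

definition sym_lebesgue :: "(real^'p::{finite,linorder}^'p::{finite,linorder}) measure" where
  "sym_lebesgue = distr (PiM lower_idx (\<lambda>_. lborel)) borel sym_of"

definition cpow :: "real \<Rightarrow> complex \<Rightarrow> complex" where
  "cpow d s = (complex_of_real d) powr s"

definition mgamma :: "nat \<Rightarrow> complex \<Rightarrow> complex" where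
  "mgamma p a = complex_of_real (pi powr (real p * (real p - 1) / 4)) *
     (\<Prod>i<p. Gamma (a - complex_of_real (real i / 2)))"

definition beta1_density :: "complex \<Rightarrow> complex \<Rightarrow> real^'p::finite^'p \<Rightarrow> complex" where
  "beta1_density z a X =
     (let p = CARD('p) in
      if posdef X \<and> mat_less X (mat 1) then
        mgamma p (z + a) / (mgamma p z * mgamma p a) *
        cpow (det X) (z - of_real ((real p + 1) / 2)) *
        cpow (det (mat 1 - X)) (a - of_real ((real p + 1) / 2))
      else 0)"

definition kober_I1 ::
  "nat \<Rightarrow> (nat \<Rightarrow> complex) \<Rightarrow> (nat \<Rightarrow> complex) \<Rightarrow>
   ((nat \<Rightarrow> real^'p::{finite,linorder}^'p::{finite,linorder}) \<Rightarrow> real) \<Rightarrow> (nat \<Rightarrow> real^'p::{finite,linorder}^'p::{finite,linorder}) \<Rightarrow> complex" where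
  "kober_I1 k z a f U =
     (let p = CARD('p) in
      (\<Prod>j<k. cpow (det (U j)) (- z j - a j) / mgamma p (a j)) *
      (LINT V : {V. \<forall>j<k. posdef (V j) \<and> mat_less (V j) (U j)} | PiM {..<k} (\<lambda>_. sym_lebesgue).
         (\<Prod>j<k. cpow (det (V j)) (z j) *
                  cpow (det (U j - V j)) (a j - of_real ((real p + 1) / 2))) *
         complex_of_real (f V)))"

end

theory Submission
  imports Defs
begin

text \<open>For fixed positive definite \<open>v\<close> with square root \<open>W\<close>, the map \<open>U \<mapsto> W U\<^sup>-\<^sup>1 W\<close> is an
  involution of the cone of positive definite matrices. Its derivative at \<open>U\<close> is, up to sign, the
  congruence \<open>H \<mapsto> C H C\<^sup>T\<close> with \<open>C = W U\<^sup>-\<^sup>1\<close>, and the determinant of this congruence on symmetric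
  matrices is \<open>det C\<close> to the power \<open>p + 1\<close>, up to sign. So, conditionally on \<open>V\<^sub>j = v\<close>, the matrix
  \<open>U\<^sub>j\<close> has the transported beta density, which is a constant multiple of the integrand of the Kober
  operator. Integrating the product of these conditional densities against the joint density of
  the \<open>V\<^sub>j\<close> gives the joint density of the \<open>U\<^sub>j\<close>, and densities are unique almost everywhere.\<close>

text \<open>\<open>msqrt\<close> is given only by a unique description, so its existence and its
  Borel measurability must both be earned. They come together from topology: squaring is a
  continuous injection of the cone into itself whose image is open and relatively closed, and the
  cone is connected; hence squaring is a homeomorphism of the cone. Symmetric matrices form a null
  set among all matrices when p > 1, so the substitution takes place in the coordinates on and below
  the diagonal, where Lebesgue measure is the measure dX of the statement. The exponent p + 1 of the
  Jacobian is obtained from multiplicativity: the absolute determinant of a congruence is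
  multiplicative in \<open>C\<close>, so it is enough to know it on diagonal matrices, swaps and
  transvections. On a diagonal matrix it is a count of index pairs. The parameters are complex
  whereas densities are real. Before any law can be transported, the beta density has to be shown
  real and nonnegative at every point, although the hypothesis identifies it only almost
  everywhere.\<close>

section \<open>Matrix products, inverses and determinants\<close>

lemma bounded_bilinear_matrix_mult:
  "bounded_bilinear ((**) :: real^'n::finite^'m::finite \<Rightarrow> real^'k::finite^'n \<Rightarrow> real^'k^'m)"
  unfolding bilinear_conv_bounded_bilinear[symmetric] bilinear_def
  by (auto intro!: linearI simp: matrix_matrix_mult_def vec_eq_iff sum.distrib sum_distrib_left algebra_simps)

lemma bounded_bilinear_matrix_vector_mult:
  "bounded_bilinear ((*v) :: real^'n::finite^'m::finite \<Rightarrow> real^'n \<Rightarrow> real^'m)"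
  unfolding bilinear_conv_bounded_bilinear[symmetric] bilinear_def
  by (auto intro!: linearI simp: matrix_vector_mult_add_rdistrib matrix_vector_right_distrib
        matrix_vector_mult_scaleR scaleR_matrix_vector_assoc)

lemmas continuous_on_matrix_mult [continuous_intros] =
  bounded_bilinear.continuous_on[OF bounded_bilinear_matrix_mult]
lemmas continuous_on_matrix_vector_mult [continuous_intros] =
  bounded_bilinear.continuous_on[OF bounded_bilinear_matrix_vector_mult]

lemma bounded_linear_transpose:
  "bounded_linear (transpose :: real^'n::finite^'m::finite \<Rightarrow> real^'m^'n)"
  unfolding linear_conv_bounded_linear[symmetric]
  by (auto intro!: linearI simp: transpose_def vec_eq_iff)

lemmas transpose_diff = linear_diff[OF bounded_linear.linear[OF bounded_linear_transpose]]
lemmas matrix_mult_diff_left = bounded_bilinear.diff_left[OF bounded_bilinear_matrix_mult]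
lemmas matrix_mult_diff_right = bounded_bilinear.diff_right[OF bounded_bilinear_matrix_mult]

lemma matrix_inv_both:
  fixes A :: "real^'n::finite^'n"
  assumes "det A \<noteq> 0"
  shows "A ** matrix_inv A = mat 1" "matrix_inv A ** A = mat 1"
proof -
  have "\<exists>B. A ** B = mat 1 \<and> B ** A = mat 1"
    using assms invertible_det_nz invertible_def by blast
  from someI_ex[OF this] show "A ** matrix_inv A = mat 1" "matrix_inv A ** A = mat 1"
    by (auto simp: matrix_inv_def)
qed

lemma matrix_inv_unique:
  fixes A :: "real^'n::finite^'n"
  assumes "A ** B = mat 1"
  shows "matrix_inv A = B"
proof -
  have "det A * det B = 1" using assms det_mul[of A B] by simp
  then have "det A \<noteq> 0" by auto
  note i = matrix_inv_both[OF this]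
  have "matrix_inv A = matrix_inv A ** (A ** B)" by (simp add: assms)
  also have "\<dots> = B" by (simp add: matrix_mul_assoc i)
  finally show ?thesis .
qed

lemma det_matrix_inv:
  fixes A :: "real^'n::finite^'n"
  assumes "det A \<noteq> 0"
  shows "det (matrix_inv A) = inverse (det A)"
proof -
  have "det A * det (matrix_inv A) = 1"
    using matrix_inv_both(1)[OF assms] det_mul[of A "matrix_inv A"] by simp
  then show ?thesis by (metis inverse_unique)
qed

lemma continuous_on_det [continuous_intros]:
  fixes f :: "'a::topological_space \<Rightarrow> real^'n::finite^'n"
  assumes "continuous_on S f"
  shows "continuous_on S (\<lambda>x. det (f x))"
  unfolding det_def by (intro continuous_intros assms)

text \<open>Cramer's rule for the basis vectors. It makes each entry of the inverse a quotient of
  determinants, so continuity of inversion reduces to continuity of \<open>det\<close>.\<close>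

lemma matrix_inv_cramer:
  fixes A :: "real^'n::finite^'n"
  assumes "det A \<noteq> 0"
  shows "matrix_inv A = (\<chi> k l. det (\<chi> i j. if j = k then axis l 1 $ i else A$i$j) / det A)"
proof -
  have "matrix_inv A $ k $ l = det (\<chi> i j. if j = k then axis l 1 $ i else A$i$j) / det A" for k l
  proof -
    have "A *v (matrix_inv A *v axis l 1) = axis l 1"
      by (simp add: matrix_vector_mul_assoc matrix_inv_both[OF assms])
    then have "matrix_inv A *v axis l 1 = (\<chi> k. det (\<chi> i j. if j = k then axis l 1 $ i else A$i$j) / det A)"
      by (simp add: cramer[OF assms])
    then show ?thesis by (simp add: vec_eq_iff matrix_vector_mult_basis column_def)
  qed
  then show ?thesis by (simp add: vec_eq_iff)
qed

lemma continuous_on_matrix_inv: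
  fixes f :: "'a::topological_space \<Rightarrow> real^'n::finite^'n"
  assumes "continuous_on S f" "\<And>x. x \<in> S \<Longrightarrow> det (f x) \<noteq> 0"
  shows "continuous_on S (\<lambda>x. matrix_inv (f x))"
proof -
  have "continuous_on S (\<lambda>x. \<chi> k l. det (\<chi> i j. if j = k then axis l 1 $ i else f x$i$j) / det (f x))"
  proof (intro continuous_on_vec_lambda continuous_on_divide continuous_on_det)
    show "continuous_on S (\<lambda>x. if j = k then axis l 1 $ i else f x $ i $ j)" for i j k l
      by (cases "j = k") (auto intro!: continuous_intros assms(1))
  qed (use assms in auto)
  then show ?thesis
    by (rule continuous_on_eq) (simp add: matrix_inv_cramer assms(2))
qed

section \<open>Positive definite matrices\<close>

lemma posdefD:
  assumes "posdef A"
  shows "transpose A = A" "x \<noteq> 0 \<Longrightarrow> x \<bullet> (A *v x) > 0" "x \<bullet> (A *v x) \<ge> 0"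
  using assms by (auto simp: posdef_def symmetric_mat_def intro: less_imp_le) (cases "x = 0", auto intro: less_imp_le)

lemma posdef_mat_1: "posdef (mat 1 :: real^'n::finite^'n)"
  by (auto simp: posdef_def symmetric_mat_def transpose_mat)

lemma posdef_add: "posdef A \<Longrightarrow> posdef B \<Longrightarrow> posdef (A + B)"
  by (auto simp: posdef_def symmetric_mat_def transpose_def vec_eq_iff matrix_vector_mult_add_rdistrib
      inner_add_right add_pos_pos)

lemma posdef_scaleR: "posdef A \<Longrightarrow> c > 0 \<Longrightarrow> posdef (c *\<^sub>R A)"
  by (auto simp: posdef_def symmetric_mat_def transpose_def vec_eq_iff scaleR_matrix_vector_assoc[symmetric])

lemma posdef_det_nz:
  assumes "posdef A"
  shows "det A \<noteq> 0"
proof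
  assume "det A = 0"
  then obtain x where "x \<noteq> 0" "A *v x = 0"
    using matrix_left_invertible_ker[of A] invertible_left_inverse[of A] invertible_det_nz[of A] by blast
  with posdefD(2)[OF assms, of x] show False by simp
qed

lemma dot_matrix_mult: "x \<bullet> (A *v y) = (transpose A *v x) \<bullet> (y :: real^'n::finite)"
  by (metis dot_lmul_matrix vector_transpose_matrix transpose_transpose)

text \<open>The quadratic form at \<open>x\<close> is that of \<open>A\<close> at
  \<open>transpose C *v x\<close>, which is nonzero because \<open>C\<close> is invertible.\<close>

lemma posdef_congruence:
  fixes A C :: "real^'n::finite^'n"
  assumes "posdef A" "det C \<noteq> 0"
  shows "posdef (C ** A ** transpose C)"
  unfolding posdef_def symmetric_mat_def
proof (intro conjI allI impI)
  show "transpose (C ** A ** transpose C) = C ** A ** transpose C"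
    by (simp add: matrix_transpose_mul transpose_transpose posdefD(1)[OF assms(1)] matrix_mul_assoc)
  fix x :: "real^'n" assume "x \<noteq> 0"
  moreover have "x = transpose (matrix_inv C) *v (transpose C *v x)"
    using arg_cong[OF matrix_inv_both(1)[OF assms(2)], of transpose]
    by (simp add: matrix_vector_mul_assoc matrix_transpose_mul transpose_mat del: transpose_matrix_vector)
  ultimately have "transpose C *v x \<noteq> 0" by auto
  from posdefD(2)[OF assms(1) this] show "0 < x \<bullet> (C ** A ** transpose C *v x)"
    by (simp add: dot_matrix_mult[of x C] matrix_vector_mul_assoc[symmetric])
qed

lemma posdef_congruence_iff:
  fixes A C :: "real^'n::finite^'n"
  assumes "det C \<noteq> 0"
  shows "posdef (C ** A ** transpose C) \<longleftrightarrow> posdef A"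
proof
  assume *: "posdef (C ** A ** transpose C)"
  let ?D = "matrix_inv C"
  have "posdef (?D ** (C ** A ** transpose C) ** transpose ?D)"
    using posdef_congruence[OF *, of ?D] assms by (simp add: det_matrix_inv)
  also have "?D ** (C ** A ** transpose C) ** transpose ?D = (?D ** C) ** A ** transpose (?D ** C)"
    by (simp add: matrix_transpose_mul matrix_mul_assoc)
  finally show "posdef A" by (simp add: matrix_inv_both[OF assms] transpose_mat)
qed (use assms posdef_congruence in blast)

text \<open>With \<open>?B\<close> the inverse, \<open>?B ** A ** transpose ?B = ?B\<close> displays
  the inverse as a congruence of \<open>A\<close> itself.\<close>

lemma posdef_matrix_inv:
  fixes A :: "real^'n::finite^'n"
  assumes "posdef A"
  shows "posdef (matrix_inv A)"
proof -
  let ?B = "matrix_inv A"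
  note i = matrix_inv_both[OF posdef_det_nz[OF assms]]
  have t: "transpose ?B = ?B"
  proof (rule matrix_inv_unique[symmetric])
    show "A ** transpose ?B = mat 1"
      using arg_cong[OF i(2), of transpose] by (simp add: matrix_transpose_mul transpose_mat posdefD[OF assms])
  qed
  have "posdef (?B ** A ** transpose ?B)"
    using assms by (intro posdef_congruence) (auto simp: det_matrix_inv posdef_det_nz)
  then show ?thesis by (simp add: i t)
qed

section \<open>Lower-triangular coordinates of symmetric matrices\<close>

text \<open>As a type of its own, the index set turns the coordinates into vectors of the shape
  \<open>real^'n\<close>, for which Lebesgue measure, derivatives and Jacobian determinants are
  available.\<close>

typedef (overloaded) ('p::linorder) lowidx = "lower_idx :: ('p \<times> 'p) set"
  by (auto simp: lower_idx_def)

abbreviation rowix :: "'p::linorder lowidx \<Rightarrow> 'p" where "rowix i \<equiv> fst (Rep_lowidx i)"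
abbreviation colix :: "'p::linorder lowidx \<Rightarrow> 'p" where "colix i \<equiv> snd (Rep_lowidx i)"

lemma colix_le_rowix: "colix i \<le> rowix i"
  using Rep_lowidx[of i] by (auto simp: lower_idx_def split: prod.splits)

lemma lowidx_eqI: "rowix i = rowix j \<Longrightarrow> colix i = colix j \<Longrightarrow> i = j"
  by (metis Rep_lowidx_inject prod.collapse)

instance lowidx :: ("{finite,linorder}") finite
proof
  have "UNIV = Abs_lowidx ` (lower_idx :: ('a \<times> 'a) set)"
    using type_definition.univ[OF type_definition_lowidx] .
  then show "finite (UNIV :: 'a lowidx set)"
    by (metis finite_imageI finite_code)
qed

text \<open>The change of variables theorem of the library needs a well-ordered index type; the choice
  of the order is irrelevant.\<close>

instantiation lowidx :: ("{finite,linorder}") wellorder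
begin

definition less_eq_lowidx :: "'a lowidx \<Rightarrow> 'a lowidx \<Rightarrow> bool" where
  "less_eq_lowidx i j \<longleftrightarrow> rowix i < rowix j \<or> rowix i = rowix j \<and> colix i \<le> colix j"

definition less_lowidx :: "'a lowidx \<Rightarrow> 'a lowidx \<Rightarrow> bool" where
  "less_lowidx i j \<longleftrightarrow> rowix i < rowix j \<or> rowix i = rowix j \<and> colix i < colix j"

instance
proof
  fix i j k :: "'a lowidx" and P :: "'a lowidx \<Rightarrow> bool"
  show "i < j \<longleftrightarrow> i \<le> j \<and> \<not> j \<le> i" "i \<le> i" "i \<le> j \<or> j \<le> i"
    by (auto simp: less_eq_lowidx_def less_lowidx_def)
  show "i \<le> j \<Longrightarrow> j \<le> k \<Longrightarrow> i \<le> k"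
    by (auto simp: less_eq_lowidx_def)
  show "i \<le> j \<Longrightarrow> j \<le> i \<Longrightarrow> i = j"
    by (auto simp: less_eq_lowidx_def intro: lowidx_eqI)
  have tr: "trans {(x, y :: 'a lowidx). x < y}" and ir: "irrefl {(x, y :: 'a lowidx). x < y}"
    by (auto simp: less_lowidx_def intro!: transI irreflI)
  have "wf {(x, y :: 'a lowidx). x < y}"
    using tr ir by (intro finite_acyclic_wf) (auto simp: acyclic_irrefl trancl_id)
  then show "(\<And>x. (\<And>y. y < x \<Longrightarrow> P y) \<Longrightarrow> P x) \<Longrightarrow> P i"
    by (rule wf_induct_rule) auto
qed

end

definition mat_of :: "real^('p::{finite,linorder}) lowidx \<Rightarrow> real^'p::{finite,linorder}^'p::{finite,linorder}" where
  "mat_of y = (\<chi> i j. if j \<le> i then y $ Abs_lowidx (i, j) else y $ Abs_lowidx (j, i))"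

definition lower_of :: "real^'p::{finite,linorder}^'p::{finite,linorder} \<Rightarrow> real^('p::{finite,linorder}) lowidx" where
  "lower_of A = (\<chi> i. A $ rowix i $ colix i)"

lemma Rep_Abs_lowidx: "j \<le> i \<Longrightarrow> Rep_lowidx (Abs_lowidx (i, j)) = (i, j)"
  by (rule Abs_lowidx_inverse) (auto simp: lower_idx_def)

lemma transpose_mat_of [simp]: "transpose (mat_of y) = mat_of y"
  by (auto simp: transpose_def mat_of_def vec_eq_iff)

lemma lower_of_mat_of [simp]: "lower_of (mat_of y) = y"
  by (auto simp: lower_of_def mat_of_def vec_eq_iff colix_le_rowix Rep_lowidx_inverse)

lemma mat_of_lower_of: "transpose A = A \<Longrightarrow> mat_of (lower_of A) = A"
  by (auto simp: lower_of_def mat_of_def vec_eq_iff Rep_Abs_lowidx transpose_def not_le)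

lemma bounded_linear_mat_of: "bounded_linear mat_of"
  unfolding linear_conv_bounded_linear[symmetric]
  by (rule linearI) (auto simp: mat_of_def vec_eq_iff)

lemma bounded_linear_lower_of: "bounded_linear lower_of"
  unfolding linear_conv_bounded_linear[symmetric]
  by (rule linearI) (auto simp: lower_of_def vec_eq_iff)

lemmas continuous_on_mat_of [continuous_intros] = bounded_linear.continuous_on[OF bounded_linear_mat_of]
lemmas continuous_on_lower_of [continuous_intros] = bounded_linear.continuous_on[OF bounded_linear_lower_of]

section \<open>Openness and convexity of the cone in coordinates\<close>

text \<open>The complement is the projection of a closed set of pairs along the compact unit sphere,
  hence closed. Restricting to unit vectors is harmless, as scaling \<open>x\<close> keeps the sign
  of the quadratic form.\<close>

lemma open_posdef_coords: "open {y. posdef (mat_of y)}"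
proof -
  have "closed {y. \<exists>x. x \<in> sphere (0::real^'p::{finite,linorder}) 1 \<and> (x, y) \<in> {(x, y). x \<bullet> (mat_of y *v x) \<le> 0}}"
    unfolding case_prod_unfold
    by (intro closed_compact_projection compact_sphere closed_Collect_le continuous_intros)
  also have "{y. \<exists>x. x \<in> sphere (0::real^'p::{finite,linorder}) 1 \<and> (x, y) \<in> {(x, y). x \<bullet> (mat_of y *v x) \<le> 0}}
     = - {y. posdef (mat_of y)}"
  proof (safe)
    fix y assume "\<not> posdef (mat_of y)"
    then obtain x where x: "x \<noteq> 0" "x \<bullet> (mat_of y *v x) \<le> 0"
      by (auto simp: posdef_def symmetric_mat_def not_less)
    let ?x = "x /\<^sub>R norm x"
    have "?x \<bullet> (mat_of y *v ?x) \<le> 0"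
      using x by (auto simp: matrix_vector_mult_scaleR mult_le_0_iff zero_le_mult_iff)
    moreover have "?x \<in> sphere 0 1" using x by simp
    ultimately show "\<exists>x. x \<in> sphere 0 1 \<and> (x, y) \<in> {(x, y). x \<bullet> (mat_of y *v x) \<le> 0}"
      by blast
  next
    fix y :: "real^'p::{finite,linorder} lowidx" and x :: "real^'p::{finite,linorder}"
    assume "posdef (mat_of y)" "x \<in> sphere 0 1" "x \<bullet> (mat_of y *v x) \<le> 0"
    then show False using posdefD(2)[of "mat_of y" x] by force
  qed
  finally show ?thesis by (simp add: open_closed)
qed

lemma open_posdef_diff_coords: "open {y. posdef (A - mat_of y)}" if "transpose A = A"
proof -
  have "A - mat_of y = mat_of (lower_of A - y)" for y
    using mat_of_lower_of[OF that] by (simp add: linear_diff[OF bounded_linear.linear[OF bounded_linear_mat_of]])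
  moreover have "open ((\<lambda>y. lower_of A - y) -` {y. posdef (mat_of y)})"
    by (intro open_vimage open_posdef_coords continuous_intros)
  ultimately show ?thesis by (simp add: vimage_def)
qed

lemma posdef_convex_combination:
  assumes "posdef A" "posdef B" "0 \<le> u" "0 \<le> v" "u + v = 1"
  shows "posdef (u *\<^sub>R A + v *\<^sub>R B)"
proof -
  \<comment> \<open>Zero weights are treated apart, since scaling by zero leaves the cone.\<close>
  consider "u = 0" "v = 1" | "u = 1" "v = 0" | "u > 0" "v > 0" using assms by fastforce
  then show ?thesis
    by cases (use assms in \<open>auto intro!: posdef_add posdef_scaleR\<close>)
qed

text \<open>Convexity is wanted for connectedness: of the cone in the construction of the square
  root, and of the region between 0 and I in the sign argument for the beta density.\<close>

lemma convex_posdef_coords: "convex {y. posdef (mat_of y)}"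
  by (rule convexI)
     (simp add: posdef_convex_combination linear_add[OF bounded_linear.linear[OF bounded_linear_mat_of]]
        linear_scale[OF bounded_linear.linear[OF bounded_linear_mat_of]])

lemma convex_posdef_diff_coords:
  fixes A :: "real^'p::{finite,linorder}^'p::{finite,linorder}"
  shows "convex {y. posdef (A - mat_of y)}"
proof (rule convexI, unfold mem_Collect_eq)
  fix x y :: "real^('p::{finite,linorder}) lowidx" and u v :: real
  assume *: "posdef (A - mat_of x)" "posdef (A - mat_of y)" "0 \<le> u" "0 \<le> v" "u + v = 1"
  have "A - mat_of (u *\<^sub>R x + v *\<^sub>R y) = (u + v) *\<^sub>R A - mat_of (u *\<^sub>R x + v *\<^sub>R y)"
    by (simp add: *)
  also have "\<dots> = u *\<^sub>R (A - mat_of x) + v *\<^sub>R (A - mat_of y)"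
    by (simp add: linear_add[OF bounded_linear.linear[OF bounded_linear_mat_of]]
        linear_scale[OF bounded_linear.linear[OF bounded_linear_mat_of]] algebra_simps)
  finally show "posdef (A - mat_of (u *\<^sub>R x + v *\<^sub>R y))"
    using posdef_convex_combination[OF *] by simp
qed

subsection \<open>The positive definite square root\<close>

text \<open>The trace is the sum of the quadratic form of \<open>B\<close> over the columns of
  \<open>D\<close>, so it vanishes only if every column does.\<close>

lemma trace_congruence_nonneg:
  assumes "posdef (B :: real^'p::finite^'p)"
  shows "trace (transpose D ** B ** D) \<ge> 0"
    and "trace (transpose D ** B ** D) = 0 \<Longrightarrow> D = 0"
proof -
  have *: "(transpose D ** B ** D) $ i $ i = column i D \<bullet> (B *v column i D)" for i
  proof -
    have "(transpose D ** B ** D) $ i $ i = axis i 1 \<bullet> (transpose D ** B ** D *v axis i 1)"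
      by (simp add: matrix_vector_mult_basis column_def inner_axis' del: transpose_matrix_vector)
    also have "\<dots> = (D *v axis i 1) \<bullet> (B *v (D *v axis i 1))"
      using dot_matrix_mult[of "axis i 1" "transpose D" "B *v (D *v axis i 1)"]
      by (simp add: matrix_vector_mul_assoc matrix_mul_assoc del: transpose_matrix_vector)
    finally show ?thesis by (simp add: matrix_vector_mult_basis)
  qed
  show "trace (transpose D ** B ** D) \<ge> 0"
    unfolding trace_def * by (intro sum_nonneg posdefD(3)[OF assms])
  assume "trace (transpose D ** B ** D) = 0"
  then have "\<forall>i. column i D \<bullet> (B *v column i D) = 0"
    unfolding trace_def * by (subst (asm) sum_nonneg_eq_0_iff) (auto intro: posdefD(3)[OF assms])
  then have "column i D = 0" for i using posdefD(2)[OF assms] by (metis less_irrefl)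
  then show "D = 0" by (auto simp: column_def vec_eq_iff)
qed

text \<open>With \<^term>\<open>D = B - C\<close> we have \<^term>\<open>B ** D + D ** C = 0\<close>, so the traces of
  \<^term>\<open>D ** B ** D\<close> and of \<^term>\<open>D ** C ** D\<close> add up to zero.\<close>

lemma posdef_sqrt_unique:
  fixes B C :: "real^'p::finite^'p"
  assumes "posdef B" "posdef C" "B ** B = C ** C"
  shows "B = C"
proof -
  let ?D = "B - C"
  have t: "transpose ?D = ?D"
    by (simp add: transpose_diff posdefD(1)[OF assms(1)] posdefD(1)[OF assms(2)])
  have "B ** ?D + ?D ** C = 0"
    by (simp add: matrix_mult_diff_left matrix_mult_diff_right assms(3))
  then have "trace (?D ** (B ** ?D + ?D ** C)) = 0" by (simp add: trace_def)
  also have "trace (?D ** (B ** ?D + ?D ** C)) = trace (?D ** B ** ?D) + trace (?D ** (?D ** C))"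
    by (simp add: matrix_add_ldistrib trace_add matrix_mul_assoc)
  also have "trace (?D ** (?D ** C)) = trace (?D ** C ** ?D)"
    by (subst trace_mul_sym) simp
  finally have "trace (?D ** B ** ?D) = 0"
    using trace_congruence_nonneg(1)[OF assms(1), of ?D] trace_congruence_nonneg(1)[OF assms(2), of ?D] t
    by simp
  then have "?D = 0" using trace_congruence_nonneg(2)[OF assms(1), of ?D] t by simp
  then show ?thesis by simp
qed


lemma posdef_square:
  assumes "posdef A"
  shows "posdef (A ** A)"
  using posdef_congruence[OF posdef_mat_1 posdef_det_nz[OF assms]] by (simp add: posdefD(1)[OF assms])

text \<open>Needed for limits of positive definite roots, which are a priori only semidefinite. If
  the form vanished at some nonzero \<open>x\<close>, a small step from \<open>x\<close> against
  \<open>B *v x\<close> would make it negative.\<close>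

lemma posdef_if_posdef_square:
  fixes B :: "real^'p::finite^'p"
  assumes "transpose B = B" and psd: "\<And>x. x \<bullet> (B *v x) \<ge> 0" and sq: "posdef (B ** B)"
  shows "posdef B"
  unfolding posdef_def symmetric_mat_def
proof (intro conjI allI impI)
  fix x :: "real^'p" assume "x \<noteq> 0"
  show "0 < x \<bullet> (B *v x)"
  proof (rule ccontr)
    assume "\<not> 0 < x \<bullet> (B *v x)"
    then have 0: "x \<bullet> (B *v x) = 0" using psd[of x] by simp
    define y where "y = B *v x"
    define c where "c = y \<bullet> (B *v y)"
    \<comment> \<open>The form at \<open>x - e *\<^sub>R y\<close> is
      \<open>- 2 * e * (y \<bullet> y) + e\<^sup>2 * c\<close>. This \<open>e\<close> satisfies
      \<open>e * (c + 1) = y \<bullet> y\<close>, which leaves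
      \<open>- (e * (y \<bullet> y)) - e\<^sup>2\<close>; the summand 1 keeps the denominator
      positive when \<open>c = 0\<close>.\<close>
    define e where "e = (y \<bullet> y) / (c + 1)"
    have c: "c \<ge> 0" unfolding c_def by (rule psd)
    have sym: "u \<bullet> (B *v v) = (B *v u) \<bullet> v" for u v
      using dot_matrix_mult[of u B v] assms(1) by simp
    have "y \<bullet> y = x \<bullet> (B ** B *v x)"
      by (simp add: y_def sym matrix_vector_mul_assoc[symmetric])
    then have y: "y \<bullet> y > 0" using posdefD(2)[OF sq \<open>x \<noteq> 0\<close>] by simp
    have "0 \<le> (x - e *\<^sub>R y) \<bullet> (B *v (x - e *\<^sub>R y))" by (rule psd)
    also have "\<dots> = - 2 * e * (y \<bullet> y) + e\<^sup>2 * c"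
      using 0 sym[of x y]
      by (simp add: matrix_vector_mult_diff_distrib matrix_vector_mult_scaleR inner_diff_left inner_diff_right
          y_def[symmetric] c_def[symmetric] power2_eq_square algebra_simps)
    also have "\<dots> = - (e * (y \<bullet> y)) - e\<^sup>2"
    proof -
      have "e * (c + 1) = y \<bullet> y" using c by (simp add: e_def)
      then have "e * c = y \<bullet> y - e" by (simp add: algebra_simps)
      then have "e * (e * c) = e * (y \<bullet> y - e)" by simp
      then show ?thesis by (simp add: power2_eq_square algebra_simps)
    qed
    also have "\<dots> < 0"
    proof -
      have "e > 0" using y c by (simp add: e_def)
      then have "e * (y \<bullet> y) > 0" "e\<^sup>2 > 0" using y by simp_all
      then show ?thesis by linarith
    qed
    finally show False by simp
  qed
qed fact

text \<open>A diagonal entry of the square of a symmetric matrix is the sum of the squares of a row.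
  This bounds roots in terms of their squares.\<close>

lemma matrix_entry_square_le:
  fixes A :: "real^'p::finite^'p"
  assumes "transpose A = A"
  shows "(A $ i $ j)\<^sup>2 \<le> (A ** A) $ i $ i"
proof -
  have "A $ i $ k * A $ k $ i = (A $ i $ k)\<^sup>2" for k
    using assms by (auto simp: transpose_def vec_eq_iff power2_eq_square)
  then have "(A ** A) $ i $ i = (\<Sum>k\<in>UNIV. (A $ i $ k)\<^sup>2)"
    by (simp add: matrix_matrix_mult_def)
  then show ?thesis using member_le_sum[of j UNIV "\<lambda>k. (A $ i $ k)\<^sup>2"] by simp
qed

text \<open>Stated in coordinates because invariance of domain concerns maps between open sets of a
  Euclidean space of one dimension.\<close>

lemma posdef_sqrt_homeomorphism:
  fixes P :: "(real^('p::{finite,linorder}) lowidx) set"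
  defines "P \<equiv> {y. posdef (mat_of y)}"
  obtains g where "homeomorphism P P (\<lambda>y. lower_of (mat_of y ** mat_of y)) g"
proof -
  define s where "s = (\<lambda>y :: real^'p lowidx. lower_of (mat_of y ** mat_of y))"
  have ms: "mat_of (s y) = mat_of y ** mat_of y" for y
    unfolding s_def by (rule mat_of_lower_of) (simp add: matrix_transpose_mul)
  have sP: "s ` P \<subseteq> P" by (auto simp: P_def ms posdef_square)
  have cont: "continuous_on A s" for A
    unfolding s_def by (intro continuous_intros)
  have inj: "inj_on s P"
    by (rule inj_onI, metis (mono_tags) P_def lower_of_mat_of mem_Collect_eq ms posdef_sqrt_unique)
  have oP: "open P" unfolding P_def by (rule open_posdef_coords)
  have osP: "open (s ` P)" by (rule invariance_of_domain[OF cont oP inj])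
  \<comment> \<open>Relative closedness: if the squares converge to \<open>q\<close>, the roots are
    bounded, so a subsequence converges to a semidefinite \<open>l\<close> with square
    \<open>q\<close>; as \<open>q\<close> lies in the cone, so does \<open>l\<close>.\<close>
  have cl: "q \<in> s ` P" if q: "q \<in> P" "q \<in> closure (s ` P)" for q
  proof -
    obtain x where x: "\<And>n. x n \<in> P" and lim: "(\<lambda>n. s (x n)) \<longlonglongrightarrow> q"
    proof -
      obtain w where w: "\<And>n::nat. w n \<in> s ` P" "w \<longlonglongrightarrow> q" using q(2) by (auto simp: closure_sequential)
      then have "\<forall>n. \<exists>x. x \<in> P \<and> w n = s x" by blast
      then obtain x where x: "\<And>n. x n \<in> P" "\<And>n. w n = s (x n)" by metis
      from x(2) have "w = (\<lambda>n. s (x n))" by (rule ext)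
      with w(2) x(1) show thesis using that by blast
    qed
    from lim have "Bseq (\<lambda>n. s (x n))" by (rule convergent_imp_Bseq[OF convergentI])
    then obtain K where K: "\<And>n. norm (s (x n)) \<le> K" by (auto simp: Bseq_def)
    have ent: "\<bar>x n $ i\<bar> \<le> sqrt K" for n i
    proof -
      let ?A = "mat_of (x n)"
      have "(?A $ rowix i $ colix i)\<^sup>2 \<le> (?A ** ?A) $ rowix i $ rowix i"
        by (rule matrix_entry_square_le) simp
      also have "\<dots> = s (x n) $ Abs_lowidx (rowix i, rowix i)"
        by (simp add: s_def lower_of_def Rep_Abs_lowidx)
      also have "\<dots> \<le> K" using component_le_norm_cart[of "s (x n)"] K[of n] by (meson abs_le_D1 order_trans)
      finally have "(x n $ i)\<^sup>2 \<le> K"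
        by (simp add: mat_of_def colix_le_rowix Rep_lowidx_inverse)
      then show ?thesis by (simp add: real_le_rsqrt)
    qed
    have "bounded (range x)"
      unfolding bounded_iff
    proof (intro exI ballI)
      fix y assume "y \<in> range x"
      then obtain n where "y = x n" by blast
      have "norm (x n) \<le> (\<Sum>i\<in>UNIV. \<bar>x n $ i\<bar>)" by (rule norm_le_l1_cart)
      also have "\<dots> \<le> (\<Sum>i\<in>(UNIV :: 'p::{finite,linorder} lowidx set). sqrt K)" by (intro sum_mono ent)
      finally show "norm y \<le> (\<Sum>i\<in>(UNIV :: 'p::{finite,linorder} lowidx set). sqrt K)" unfolding \<open>y = x n\<close> .
    qed
    then obtain l r where r: "strict_mono r" "(x \<circ> r) \<longlonglongrightarrow> l"
      using bounded_imp_convergent_subsequence by blast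
    have "(\<lambda>n. s ((x \<circ> r) n)) \<longlonglongrightarrow> s l"
      using continuous_on_tendsto_compose[OF cont[of UNIV] r(2)] by simp
    moreover have "(\<lambda>n. s ((x \<circ> r) n)) \<longlonglongrightarrow> q"
      using LIMSEQ_subseq_LIMSEQ[OF lim r(1)] by (simp add: o_def)
    ultimately have sl: "s l = q" by (rule LIMSEQ_unique)
    have "posdef (mat_of l)"
    proof (rule posdef_if_posdef_square)
      fix v :: "real^'p::{finite,linorder}"
      have "continuous_on UNIV (\<lambda>y. v \<bullet> (mat_of y *v v))" by (intro continuous_intros)
      from continuous_on_tendsto_compose[OF this r(2)]
      have "(\<lambda>n. v \<bullet> (mat_of ((x \<circ> r) n) *v v)) \<longlonglongrightarrow> v \<bullet> (mat_of l *v v)" by simp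
      then show "v \<bullet> (mat_of l *v v) \<ge> 0"
        by (rule LIMSEQ_le_const) (use x posdefD(3) in \<open>auto simp: P_def\<close>)
      show "posdef (mat_of l ** mat_of l)"
        using q(1) by (simp add: ms[symmetric] sl P_def)
    qed simp
    then show ?thesis using sl by (auto simp: P_def)
  qed
  \<comment> \<open>A nonempty subset that is open and closed in a connected set is the whole set,
    so squaring is onto.\<close>
  have "connected P" unfolding P_def by (intro convex_connected convex_posdef_coords)
  moreover have "openin (top_of_set P) (s ` P)" using osP sP by (rule open_subset[rotated])
  moreover have "closedin (top_of_set P) (s ` P)"
    using cl sP by (auto simp: closedin_closed intro!: exI[of _ "closure (s ` P)"] closure_subset[THEN subsetD])
  moreover have "s ` P \<noteq> {}"
  proof -
    have "mat_of (lower_of (mat 1 :: real^'p::{finite,linorder}^'p::{finite,linorder})) = mat 1"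
      by (simp add: mat_of_lower_of transpose_mat)
    then have "lower_of (mat 1 :: real^'p::{finite,linorder}^'p::{finite,linorder}) \<in> P"
      by (simp add: P_def posdef_mat_1)
    then show ?thesis by blast
  qed
  ultimately have "s ` P = P" unfolding connected_clopen by blast
  with invariance_of_domain_homeomorphism[OF oP cont _ inj] that show thesis
    unfolding s_def by (metis le_refl)
qed

lemma msqrt_eqI:
  assumes "posdef B" "B ** B = A"
  shows "msqrt A = B"
  unfolding msqrt_def using assms posdef_sqrt_unique by (intro the_equality) auto

text \<open>Uniqueness identifies the described root with the inverse homeomorphism, and continuity
  is inherited from there.\<close>

lemma
  fixes A :: "real^'p::{finite,linorder}^'p::{finite,linorder}"
  shows posdef_msqrt: "posdef A \<Longrightarrow> posdef (msqrt A)"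
    and msqrt_square: "posdef A \<Longrightarrow> msqrt A ** msqrt A = A"
    and continuous_on_msqrt: "continuous_on {A :: real^'p::{finite,linorder}^'p::{finite,linorder}. posdef A} msqrt"
proof -
  obtain g where g: "homeomorphism {y. posdef (mat_of y)} {y. posdef (mat_of y)}
      (\<lambda>y :: real^'p lowidx. lower_of (mat_of y ** mat_of y)) g"
    using posdef_sqrt_homeomorphism by blast
  have *: "posdef (mat_of (g (lower_of A))) \<and> mat_of (g (lower_of A)) ** mat_of (g (lower_of A)) = A"
    if A: "posdef A" for A :: "real^'p::{finite,linorder}^'p::{finite,linorder}"
  proof -
    note mA = mat_of_lower_of[OF posdefD(1)[OF A]]
    have "lower_of A \<in> {y. posdef (mat_of y)}" using A by (simp add: mA)
    with g have "g (lower_of A) \<in> {y. posdef (mat_of y)}"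
      and e: "lower_of (mat_of (g (lower_of A)) ** mat_of (g (lower_of A))) = lower_of A"
      by (auto simp: homeomorphism_def)
    moreover from arg_cong[OF e, of mat_of]
    have "mat_of (g (lower_of A)) ** mat_of (g (lower_of A)) = A"
      by (simp add: mA mat_of_lower_of matrix_transpose_mul)
    ultimately show ?thesis by simp
  qed
  then have m: "msqrt A = mat_of (g (lower_of A))" if "posdef A" for A :: "real^'p::{finite,linorder}^'p::{finite,linorder}"
    using that by (intro msqrt_eqI) auto
  show "posdef A \<Longrightarrow> posdef (msqrt A)" "posdef A \<Longrightarrow> msqrt A ** msqrt A = A"
    using * m by auto
  have "continuous_on {A :: real^'p::{finite,linorder}^'p::{finite,linorder}. posdef A} (\<lambda>A. mat_of (g (lower_of A)))"
    by (intro continuous_intros continuous_on_compose2[OF homeomorphism_cont2[OF g]])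
       (auto simp: mat_of_lower_of posdefD)
  then show "continuous_on {A :: real^'p::{finite,linorder}^'p::{finite,linorder}. posdef A} msqrt"
    by (rule continuous_on_eq) (simp add: m)
qed

text \<open>The determinant is the square of that of the root, and it is nonzero.\<close>

lemma posdef_det_pos:
  fixes A :: "real^'p::{finite,linorder}^'p::{finite,linorder}"
  assumes "posdef A"
  shows "det A > 0"
proof -
  have "det A = (det (msqrt A))\<^sup>2"
    by (metis det_mul msqrt_square[OF assms] power2_eq_square)
  then show ?thesis using posdef_det_nz[OF assms] by simp
qed

text \<open>Among all matrices the cone need not be open; it is the closed subspace of symmetric
  matrices intersected with an open preimage.\<close>

lemma posdef_borel [measurable]:
  "{A :: real^'p::{finite,linorder}^'p::{finite,linorder}. posdef A} \<in> sets borel"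
proof -
  have "{A :: real^'p::{finite,linorder}^'p::{finite,linorder}. posdef A}
      = {A. transpose A = A} \<inter> lower_of -` {y. posdef (mat_of y)}"
    by (auto simp: mat_of_lower_of posdefD)
  moreover have "closed {A :: real^'p::{finite,linorder}^'p::{finite,linorder}. transpose A = A}"
    by (intro closed_Collect_eq continuous_intros linear_continuous_on bounded_linear_transpose)
  moreover have "open (lower_of -` {y :: real^'p lowidx. posdef (mat_of y)})"
    by (intro open_vimage open_posdef_coords continuous_intros)
  ultimately show ?thesis by (auto intro!: borel_closed borel_open sets.Int)
qed

subsection \<open>Congruence transformations\<close>

definition congr_map :: "real^'p::{finite,linorder}^'p::{finite,linorder} \<Rightarrow> real^('p::{finite,linorder}) lowidx \<Rightarrow> real^('p::{finite,linorder}) lowidx" where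
  "congr_map C h = lower_of (C ** mat_of h ** transpose C)"

lemma mat_of_congr_map: "mat_of (congr_map C h) = C ** mat_of h ** transpose C"
  unfolding congr_map_def
  by (rule mat_of_lower_of) (simp add: matrix_transpose_mul matrix_mul_assoc)

lemma linear_congr_map: "linear (congr_map C)"
proof -
  note l = bounded_linear.linear[OF bounded_linear_mat_of] bounded_linear.linear[OF bounded_linear_lower_of]
  note m = bounded_bilinear.add_left[OF bounded_bilinear_matrix_mult] bounded_bilinear.add_right[OF bounded_bilinear_matrix_mult]
    bounded_bilinear.scaleR_left[OF bounded_bilinear_matrix_mult] bounded_bilinear.scaleR_right[OF bounded_bilinear_matrix_mult]
  show ?thesis
    by (rule linearI) (simp_all add: congr_map_def linear_add[OF l(1)] linear_add[OF l(2)]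
        linear_scale[OF l(1)] linear_scale[OF l(2)] m)
qed

lemma congr_map_mult: "congr_map (C ** D) = congr_map C \<circ> congr_map D"
  by (rule ext) (simp add: mat_of_congr_map congr_map_def[of C] congr_map_def[of "C ** D"]
      matrix_transpose_mul matrix_mul_assoc)

lemma congr_map_1: "congr_map (mat 1) = (\<lambda>h. h)"
  by (rule ext) (simp add: congr_map_def transpose_mat)

text \<open>Only the absolute value enters a Jacobian. Taking it here gives a nonnegative
  multiplicative function, for which a square equal to one already forces the value one.\<close>

definition congr_det :: "real^'p::{finite,linorder}^'p::{finite,linorder} \<Rightarrow> real" where
  "congr_det C = \<bar>det (matrix (congr_map C))\<bar>"

lemma congr_det_mult: "congr_det (C ** D) = congr_det C * congr_det D"
  by (simp add: congr_det_def congr_map_mult matrix_compose linear_congr_map det_mul abs_mult)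

lemma congr_det_1: "congr_det (mat 1) = 1"
  by (simp add: congr_det_def congr_map_1 matrix_id_mat_1[unfolded id_def])

text \<open>The origin of the exponent p + 1: an index \<open>r\<close> is the row of
  \<open>card {..r}\<close> pairs and the column of \<open>card {r..}\<close> pairs, and the two
  sets together cover all indices, with \<open>r\<close> counted twice.\<close>

lemma prod_lower_pairs:
  fixes a :: "'p::{finite,linorder} \<Rightarrow> real"
  shows "(\<Prod>i\<in>UNIV. a (rowix i) * a (colix i)) = (\<Prod>i\<in>UNIV. a i) ^ (CARD('p) + 1)"
proof -
  have fin: "finite (UNIV :: 'p set)" by simp
  have card: "card {..r} + card {r..} = CARD('p) + 1" for r :: 'p
  proof -
    have "card ({..r} \<union> {r..}) + card ({..r} \<inter> {r..}) = card {..r} + card {r..}"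
      by (rule card_Un_Int[symmetric]) auto
    moreover have "{..r} \<union> {r..} = UNIV" "{..r} \<inter> {r..} = {r}" by auto
    ultimately show ?thesis by simp
  qed
  have L: "lower_idx = (SIGMA r:(UNIV :: 'p set). {..r})" by (auto simp: lower_idx_def)
  have "(\<Prod>i\<in>(UNIV :: 'p lowidx set). a (rowix i) * a (colix i)) = (\<Prod>(r, c)\<in>lower_idx. a r * a c)"
  proof -
    have "bij_betw Rep_lowidx (UNIV :: 'p lowidx set) lower_idx"
      using type_definition.Rep_range[OF type_definition_lowidx] by (auto simp: bij_betw_def inj_def Rep_lowidx_inject)
    from prod.reindex_bij_betw[OF this, of "\<lambda>(r, c). a r * a c"] show ?thesis
      by (simp add: case_prod_unfold)
  qed
  also have "\<dots> = (\<Prod>r\<in>UNIV. \<Prod>c\<in>{..r}. a r) * (\<Prod>r\<in>UNIV. \<Prod>c\<in>{..r}. a c)"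
    unfolding L by (subst prod.Sigma[symmetric]) (auto simp: prod.distrib)
  also have "(\<Prod>r\<in>UNIV. \<Prod>c\<in>{..r}. a c) = (\<Prod>c\<in>UNIV. \<Prod>r\<in>{c..}. a c)"
    using prod.swap_restrict[OF fin fin, of "\<lambda>r c. a c" "\<lambda>r c. c \<le> r"]
    by (simp add: atMost_def atLeast_def)
  also have "(\<Prod>r\<in>UNIV. \<Prod>c\<in>{..r}. a r) * (\<Prod>c\<in>UNIV. \<Prod>r\<in>{c..}. a c)
      = (\<Prod>r\<in>UNIV. a r ^ (card {..r} + card {r..}))"
    by (simp add: prod.distrib power_add)
  finally show ?thesis by (simp only: card prod_power_distrib)
qed

lemma
  fixes D :: "real^'p::finite^'p"
  assumes D: "\<And>i j. i \<noteq> j \<Longrightarrow> D $ i $ j = 0"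
  shows diagonal_mult_left: "(D ** M) $ r $ k = D $ r $ r * M $ r $ k"
    and diagonal_mult_right: "(N ** D) $ r $ k = N $ r $ k * D $ k $ k"
  unfolding matrix_matrix_mult_def
   by (simp, subst sum.remove[of _ r], auto intro!: sum.neutral simp: D)
      (subst sum.remove[of _ k], auto intro!: sum.neutral simp: D)

text \<open>A diagonal \<open>C\<close> acts diagonally on the coordinates: the entry at (r, c) is
  multiplied by the product of the diagonal entries at \<open>r\<close> and
  \<open>c\<close>.\<close>

lemma congr_det_diagonal:
  fixes C :: "real^'p::{finite,linorder}^'p::{finite,linorder}"
  assumes C: "\<And>i j. i \<noteq> j \<Longrightarrow> C $ i $ j = 0"
  shows "congr_det C = \<bar>det C\<bar> ^ (CARD('p) + 1)"
proof -
  have e: "(C ** M ** transpose C) $ r $ c = C $ r $ r * C $ c $ c * M $ r $ c" for M r c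
    using diagonal_mult_left[of C M r c] diagonal_mult_right[of "transpose C" "C ** M" r c] C
    by (simp add: transpose_def mult_ac)
  have m: "congr_map C h $ i = C $ rowix i $ rowix i * C $ colix i $ colix i * h $ i" for h i
    by (simp add: congr_map_def lower_of_def e mat_of_def colix_le_rowix Rep_lowidx_inverse)
  have "det (matrix (congr_map C)) = (\<Prod>i\<in>UNIV. C $ rowix i $ rowix i * C $ colix i $ colix i)"
    by (subst det_diagonal) (auto simp: matrix_def m axis_def)
  also have "\<dots> = (\<Prod>i\<in>UNIV. C $ i $ i) ^ (CARD('p) + 1)"
    by (rule prod_lower_pairs)
  also have "(\<Prod>i\<in>UNIV. C $ i $ i) = det C"
    by (rule det_diagonal[symmetric]) (simp add: C)
  finally show ?thesis by (simp add: congr_det_def abs_mult power_abs)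
qed

text \<open>The sign change of one coordinate conjugates a transvection into its inverse, so a
  multiplicative absolute value of it has square one.\<close>

lemma multiplicative_transvection:
  fixes \<phi> :: "real^'p::finite^'p \<Rightarrow> real"
  assumes mult: "\<And>A B. \<phi> (A ** B) = \<phi> A * \<phi> B" and nonneg: "\<And>A. \<phi> A \<ge> 0" and one: "\<phi> (mat 1) = 1"
    and "m \<noteq> n"
  shows "\<phi> (\<chi> i j. if i = m \<and> j = n then c else of_bool (i = j)) = 1"
proof -
  define E :: "real^'p::finite^'p" where "E = (\<chi> i j. if i = m \<and> j = n then c else 0)"
  define D :: "real^'p::finite^'p" where "D = (\<chi> i j. if i = j then if i = m then - 1 else 1 else 0)"
  have EE: "E ** E = 0"
  proof -
    have "E $ i $ k * E $ k $ j = 0" for i j k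
      using \<open>m \<noteq> n\<close> by (simp add: E_def)
    then have "(\<Sum>k\<in>UNIV. E $ i $ k * E $ k $ j) = 0" for i j by (intro sum.neutral ballI)
    then show ?thesis by (simp add: matrix_matrix_mult_def vec_eq_iff)
  qed
  have D: "D $ i $ j = 0" if "i \<noteq> j" for i j using that by (simp add: D_def)
  have DM: "(D ** M) $ r $ k = D $ r $ r * M $ r $ k" for M :: "real^'p::finite^'p" and r k
    by (rule diagonal_mult_left) (rule D)
  have MD: "(M ** D) $ r $ k = M $ r $ k * D $ k $ k" for M :: "real^'p::finite^'p" and r k
    by (rule diagonal_mult_right) (rule D)
  have DD: "D ** D = mat 1"
    unfolding vec_eq_iff DM by (simp add: D_def mat_def)
  have "D ** E = - E"
    unfolding vec_eq_iff DM by (simp add: D_def E_def)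
  moreover have "E ** D = E"
    unfolding vec_eq_iff MD using \<open>m \<noteq> n\<close> by (simp add: D_def E_def)
  ultimately have "D ** (mat 1 + E) ** D ** (mat 1 + E) = (mat 1 - E) ** (mat 1 + E)"
    by (simp add: matrix_add_ldistrib bounded_bilinear.add_left[OF bounded_bilinear_matrix_mult] DD matrix_mult_diff_left
       bounded_bilinear.minus_left[OF bounded_bilinear_matrix_mult])
  also have "\<dots> = mat 1"
    by (simp add: matrix_add_ldistrib matrix_mult_diff_left EE)
  finally have "\<phi> D * \<phi> (mat 1 + E) * \<phi> D * \<phi> (mat 1 + E) = 1"
    by (metis mult one)
  moreover have "\<phi> D * \<phi> D = 1" by (metis mult one DD)
  moreover have "\<phi> D * \<phi> (mat 1 + E) * \<phi> D * \<phi> (mat 1 + E) = (\<phi> D * \<phi> D) * (\<phi> (mat 1 + E))\<^sup>2"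
    by (simp add: power2_eq_square mult_ac)
  ultimately have "(\<phi> (mat 1 + E))\<^sup>2 = 1" by simp
  then have "\<phi> (mat 1 + E) = 1" using nonneg[of "mat 1 + E"] by (simp add: power2_eq_1_iff)
  moreover have "(\<chi> i j. if i = m \<and> j = n then c else of_bool (i = j)) = mat 1 + E"
    using \<open>m \<noteq> n\<close> by (auto simp: E_def mat_def vec_eq_iff)
  ultimately show ?thesis by simp
qed

text \<open>A swap is an involution, so its value squares to one. As with transvections, this serves
  both for \<open>congr_det\<close> and for the absolute value of \<open>det\<close>.\<close>

lemma multiplicative_swap:
  fixes \<phi> :: "real^'p::finite^'p \<Rightarrow> real"
  assumes mult: "\<And>A B. \<phi> (A ** B) = \<phi> A * \<phi> B" and nonneg: "\<And>A. \<phi> A \<ge> 0" and one: "\<phi> (mat 1) = 1"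
  shows "\<phi> (\<chi> i j. mat 1 $ i $ Transposition.transpose m n j) = 1"
proof -
  define S :: "real^'p::finite^'p" where "S = (\<chi> i j. mat 1 $ i $ Transposition.transpose m n j)"
  have "S $ i $ k * S $ k $ j = (if k = Transposition.transpose m n j then S $ i $ k else 0)" for i j k
    by (simp add: S_def mat_def)
  then have "(S ** S) $ i $ j = (\<Sum>k\<in>UNIV. if k = Transposition.transpose m n j then S $ i $ k else 0)" for i j
    by (simp add: matrix_matrix_mult_def)
  then have "(S ** S) $ i $ j = S $ i $ Transposition.transpose m n j" for i j by simp
  then have "S ** S = mat 1" by (simp add: S_def mat_def vec_eq_iff)
  then have "(\<phi> S)\<^sup>2 = 1" by (metis mult one power2_eq_square)
  then show ?thesis using nonneg[of S] by (simp add: power2_eq_1_iff S_def)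
qed

lemma congr_det_eq:
  fixes C :: "real^'p::{finite,linorder}^'p::{finite,linorder}"
  assumes "det C \<noteq> 0"
  shows "congr_det C = \<bar>det C\<bar> ^ (CARD('p) + 1)"
proof -
  note det_mult = congr_det_mult congr_det_1 det_mul abs_mult
  \<comment> \<open>The nonvanishing condition is carried through the induction: it disposes of
    matrices with a zero row, and it passes from a product to both factors.\<close>
  have "det C \<noteq> 0 \<longrightarrow> congr_det C = \<bar>det C\<bar> ^ (CARD('p) + 1)"
  proof (rule induct_matrix_elementary[of _ C])
    fix A B :: "real^'p::{finite,linorder}^'p::{finite,linorder}"
    assume "det A \<noteq> 0 \<longrightarrow> congr_det A = \<bar>det A\<bar> ^ (CARD('p) + 1)"
      "det B \<noteq> 0 \<longrightarrow> congr_det B = \<bar>det B\<bar> ^ (CARD('p) + 1)"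
    then show "det (A ** B) \<noteq> 0 \<longrightarrow> congr_det (A ** B) = \<bar>det (A ** B)\<bar> ^ (CARD('p) + 1)"
      by (simp add: det_mult power_mult_distrib)
  next
    fix A :: "real^'p::{finite,linorder}^'p::{finite,linorder}" and i
    assume "row i A = 0"
    then show "det A \<noteq> 0 \<longrightarrow> congr_det A = \<bar>det A\<bar> ^ (CARD('p) + 1)"
      by (simp add: det_zero_row)
  next
    fix A :: "real^'p::{finite,linorder}^'p::{finite,linorder}"
    assume "\<And>i j. i \<noteq> j \<Longrightarrow> A $ i $ j = 0"
    then show "det A \<noteq> 0 \<longrightarrow> congr_det A = \<bar>det A\<bar> ^ (CARD('p) + 1)"
      using congr_det_diagonal by blast
  next
    fix m n :: 'p assume "m \<noteq> n"
    let ?A = "(\<chi> i j. mat 1 $ i $ Transposition.transpose m n j) :: real^'p::{finite,linorder}^'p::{finite,linorder}"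
    have "congr_det ?A = 1"
      by (rule multiplicative_swap) (simp_all add: det_mult, simp add: congr_det_def)
    moreover have "\<bar>det ?A\<bar> = 1"
      by (rule multiplicative_swap[of "\<lambda>A. \<bar>det A\<bar>"]) (simp_all add: det_mult)
    ultimately show "det ?A \<noteq> 0 \<longrightarrow> congr_det ?A = \<bar>det ?A\<bar> ^ (CARD('p) + 1)" by simp
  next
    fix m n :: 'p and c :: real assume mn: "m \<noteq> n"
    let ?A = "(\<chi> i j. if i = m \<and> j = n then c else of_bool (i = j)) :: real^'p::{finite,linorder}^'p::{finite,linorder}"
    have "congr_det ?A = 1"
      by (rule multiplicative_transvection[OF _ _ _ mn]) (simp_all add: det_mult, simp add: congr_det_def)
    moreover have "\<bar>det ?A\<bar> = 1"
      by (rule multiplicative_transvection[OF _ _ _ mn, of "\<lambda>A. \<bar>det A\<bar>"]) (simp_all add: det_mult)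
    ultimately show "det ?A \<noteq> 0 \<longrightarrow> congr_det ?A = \<bar>det ?A\<bar> ^ (CARD('p) + 1)" by simp
  qed
  with assms show ?thesis by simp
qed

subsection \<open>Lebesgue measure on symmetric matrices\<close>

lemma borel_measurable_vec_lambda:
  fixes f :: "'a \<Rightarrow> 'n::finite \<Rightarrow> real"
  assumes "\<And>i. (\<lambda>x. f x i) \<in> borel_measurable M"
  shows "(\<lambda>x. \<chi> i. f x i) \<in> borel_measurable M"
  by (subst borel_measurable_euclidean_space) (auto simp: Basis_vec_def inner_axis assms)

text \<open>Lebesgue measure is characterised by the volumes of open boxes, and the preimage of a
  box is a box in the product space.\<close>

lemma lborel_lowidx:
  "(lborel :: (real^('p::{finite,linorder}) lowidx) measure)
    = distr (PiM (lower_idx :: ('p \<times> 'p) set) (\<lambda>_. lborel)) borel (\<lambda>x. \<chi> i. x (Rep_lowidx i))"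
    (is "_ = distr ?M borel ?f")
proof (rule lborel_eqI)
  interpret product_sigma_finite "\<lambda>_ :: 'p \<times> 'p. lborel :: real measure" by standard
  have R: "Rep_lowidx i \<in> lower_idx" for i :: "'p lowidx" by (rule Rep_lowidx)
  have m: "?f \<in> borel_measurable ?M"
    by (rule borel_measurable_vec_lambda) (use R in measurable)
  fix l u :: "real^'p lowidx"
  assume lu: "\<And>b. b \<in> Basis \<Longrightarrow> l \<bullet> b \<le> u \<bullet> b"
  have lu': "l $ i \<le> u $ i" for i using lu[of "axis i 1"] by (simp add: inner_axis axis_in_Basis_iff)
  have "?f -` box l u \<inter> space ?M = (\<Pi>\<^sub>E i\<in>lower_idx. {l $ Abs_lowidx i <..< u $ Abs_lowidx i})"
  proof (intro set_eqI iffI)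
    fix x assume "x \<in> ?f -` box l u \<inter> space ?M"
    then have x: "x \<in> extensional lower_idx" "\<And>i. l $ i < x (Rep_lowidx i) \<and> x (Rep_lowidx i) < u $ i"
      by (auto simp: space_PiM PiE_def mem_box_cart)
    have "x i \<in> {l $ Abs_lowidx i <..< u $ Abs_lowidx i}" if "i \<in> lower_idx" for i
      using x(2)[of "Abs_lowidx i"] by (simp add: Abs_lowidx_inverse[OF that])
    with x(1) show "x \<in> (\<Pi>\<^sub>E i\<in>lower_idx. {l $ Abs_lowidx i <..< u $ Abs_lowidx i})"
      by (auto simp: PiE_iff)
  next
    fix x assume "x \<in> (\<Pi>\<^sub>E i\<in>lower_idx. {l $ Abs_lowidx i <..< u $ Abs_lowidx i})"
    then have "x \<in> extensional lower_idx" "\<And>i. i \<in> lower_idx \<Longrightarrow> x i \<in> {l $ Abs_lowidx i <..< u $ Abs_lowidx i}"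
      by (auto simp: PiE_iff)
    moreover from this(2)[OF R] have "\<And>i. l $ i < x (Rep_lowidx i) \<and> x (Rep_lowidx i) < u $ i"
      by (simp add: Rep_lowidx_inverse)
    ultimately show "x \<in> ?f -` box l u \<inter> space ?M"
      by (auto simp: space_PiM mem_box_cart PiE_def)
  qed
  then have "emeasure (distr ?M borel ?f) (box l u)
      = emeasure ?M (\<Pi>\<^sub>E i\<in>lower_idx. {l $ Abs_lowidx i <..< u $ Abs_lowidx i})"
    by (subst emeasure_distr[OF m]) auto
  also have "\<dots> = (\<Prod>i\<in>lower_idx. emeasure lborel {l $ Abs_lowidx i <..< u $ Abs_lowidx i})"
    by (rule emeasure_PiM) (auto intro: finite_subset[OF subset_UNIV])
  also have "\<dots> = (\<Prod>i\<in>lower_idx. ennreal (u $ Abs_lowidx i - l $ Abs_lowidx i))"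
    by (intro prod.cong refl emeasure_lborel_Ioo lu')
  also have "\<dots> = (\<Prod>i\<in>(UNIV :: 'p lowidx set). ennreal (u $ i - l $ i))"
  proof -
    have "bij_betw Rep_lowidx (UNIV :: 'p lowidx set) lower_idx"
      using type_definition.Rep_range[OF type_definition_lowidx] by (auto simp: bij_betw_def inj_def Rep_lowidx_inject)
    from prod.reindex_bij_betw[OF this, of "\<lambda>i. ennreal (u $ Abs_lowidx i - l $ Abs_lowidx i)"] show ?thesis
      by (simp add: Rep_lowidx_inverse)
  qed
  also have "\<dots> = (\<Prod>b\<in>Basis. ennreal ((u - l) \<bullet> b))"
  proof -
    have B: "(Basis :: (real^'p lowidx) set) = (\<lambda>i. axis i 1) ` UNIV"
      by (auto simp: Basis_vec_def)
    have "inj (\<lambda>i. axis i 1 :: real^'p lowidx)" by (auto simp: inj_def axis_eq_axis)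
    then show ?thesis unfolding B by (subst prod.reindex) (simp_all add: inner_axis)
  qed
  finally show "emeasure (distr ?M borel ?f) (box l u) = ennreal (\<Prod>b\<in>Basis. (u - l) \<bullet> b)"
    using lu by (subst prod_ennreal[symmetric]) (auto simp: inner_diff_left)
qed simp

lemma borel_measurable_mat_of [measurable]: "mat_of \<in> borel \<rightarrow>\<^sub>M borel"
  by (intro borel_measurable_continuous_onI continuous_intros)

lemma borel_measurable_lower_of [measurable]: "lower_of \<in> borel \<rightarrow>\<^sub>M borel"
  by (intro borel_measurable_continuous_onI continuous_intros)

text \<open>The map \<open>sym_of\<close> factors through the coordinate vectors, so integrals of
  matrices become Lebesgue integrals, to which the change of variables rule applies.\<close>

lemma sym_lebesgue_eq:
  "(sym_lebesgue :: (real^'p::{finite,linorder}^'p::{finite,linorder}) measure) = distr lborel borel mat_of"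
proof -
  have R: "Rep_lowidx i \<in> lower_idx" for i :: "'p lowidx" by (rule Rep_lowidx)
  have m: "(\<lambda>x. \<chi> i. x (Rep_lowidx i)) \<in> borel_measurable (PiM (lower_idx :: ('p \<times> 'p) set) (\<lambda>_. lborel :: real measure))"
    by (rule borel_measurable_vec_lambda) (use R in measurable)
  have "sym_of = (\<lambda>x. mat_of (\<chi> i :: 'p lowidx. x (Rep_lowidx i)))"
    by (auto simp: fun_eq_iff sym_of_def mat_of_def vec_eq_iff Rep_Abs_lowidx not_le less_imp_le)
  then show ?thesis
    unfolding sym_lebesgue_def lborel_lowidx by (subst distr_distr[OF _ m]) (auto simp: o_def)
qed

lemma sets_sym_lebesgue [measurable_cong, simp]: "sets sym_lebesgue = sets borel"
  by (simp add: sym_lebesgue_def)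

lemma space_sym_lebesgue [simp]: "space sym_lebesgue = UNIV"
  by (simp add: sym_lebesgue_def)

lemma nn_integral_sym_lebesgue:
  assumes "f \<in> borel_measurable borel"
  shows "(\<integral>\<^sup>+ A. f A \<partial>sym_lebesgue) = (\<integral>\<^sup>+ y. f (mat_of y) \<partial>lborel)"
  unfolding sym_lebesgue_eq
proof (rule nn_integral_distr)
  show "mat_of \<in> measurable lborel borel" by simp
qed (simp add: assms)

text \<open>An image measure may fail to be sigma-finite. Here \<open>lower_of\<close> is a left
  inverse of \<open>mat_of\<close>, so the preimage of a set under \<open>lower_of\<close> has the
  Lebesgue measure of that set.\<close>

lemma sigma_finite_sym_lebesgue:
  "sigma_finite_measure (sym_lebesgue :: (real^'p::{finite,linorder}^'p::{finite,linorder}) measure)"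
proof
  obtain A :: "(real^'p lowidx) set set" where "countable A \<and> A \<subseteq> sets lborel \<and> \<Union>A = space lborel \<and>
    (\<forall>a\<in>A. emeasure lborel a \<noteq> \<infinity>)"
    using lborel.sigma_finite_countable ..
  then have A: "countable A" "A \<subseteq> sets lborel" "\<Union>A = UNIV" "\<And>a. a \<in> A \<Longrightarrow> emeasure lborel a \<noteq> \<infinity>"
    by simp_all
  have meas: "lower_of -` a \<in> sets (borel :: (real^'p::{finite,linorder}^'p::{finite,linorder}) measure)" if "a \<in> A" for a
    using measurable_sets[OF borel_measurable_lower_of, of a] A(2) that by auto
  have "emeasure sym_lebesgue (lower_of -` a :: (real^'p::{finite,linorder}^'p::{finite,linorder}) set) = emeasure lborel a" if "a \<in> A" for a
    using meas[OF that] unfolding sym_lebesgue_eq by (subst emeasure_distr) (auto simp: vimage_def)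
  then show "\<exists>A. countable A \<and> A \<subseteq> sets sym_lebesgue \<and> \<Union>A = space sym_lebesgue \<and>
    (\<forall>a\<in>A. emeasure (sym_lebesgue :: (real^'p::{finite,linorder}^'p::{finite,linorder}) measure) a \<noteq> \<infinity>)"
  proof (intro exI[of _ "(\<lambda>a. lower_of -` a) ` A"] conjI ballI)
    show "\<Union> ((\<lambda>a. lower_of -` a) ` A) = space (sym_lebesgue :: (real^'p::{finite,linorder}^'p::{finite,linorder}) measure)"
      using A(3) by auto
  qed (use A(1,4) meas in auto)
qed

subsection \<open>The substitution \<open>U \<mapsto> W U\<^sup>-\<^sup>1 W\<close>\<close>

text \<open>The resolvent identity \<open>?i Y ** (Y - X) ** ?i X = ?i X - ?i Y\<close> gives the
  exact error \<open>(?i X - ?i Y) ** (Y - X) ** ?i X\<close>. After division by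
  \<open>norm (Y - X)\<close> it tends to zero by continuity of the inverse; each of the two
  products costs a factor \<open>K\<close>.\<close>

lemma has_derivative_matrix_inv:
  fixes X :: "real^'n::finite^'n"
  assumes "det X \<noteq> 0"
  shows "(matrix_inv has_derivative (\<lambda>H. - (matrix_inv X ** H ** matrix_inv X))) (at X within S)"
proof -
  note mm = bounded_bilinear_matrix_mult
  note mm_diff = matrix_mult_diff_left matrix_mult_diff_right
  from bounded_bilinear.pos_bounded[OF mm[where 'n='n and 'm='n and 'k='n]]
  obtain K where K: "K > 0" "\<forall>a b. norm ((a :: real^'n::finite^'n) ** (b :: real^'n^'n)) \<le> norm a * norm b * K"
    by (elim exE conjE)
  let ?i = "matrix_inv :: real^'n::finite^'n \<Rightarrow> _"
  have op: "open {Y :: real^'n::finite^'n. det Y \<noteq> 0}"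
    by (intro open_Collect_neq continuous_intros)
  have "continuous_on {Y :: real^'n::finite^'n. det Y \<noteq> 0} ?i"
    by (intro continuous_on_matrix_inv continuous_on_id) auto
  then have "\<forall>Y\<in>{Y. det Y \<noteq> 0}. isCont ?i Y"
    by (simp only: continuous_on_eq_continuous_at[OF op])
  then have "isCont ?i X" using assms by simp
  then have lim: "(?i \<longlongrightarrow> ?i X) (at X within S)"
    unfolding isCont_def by (rule tendsto_within_subset) simp
  have ev: "\<forall>\<^sub>F Y in at X within S. det Y \<noteq> 0 \<and> Y \<noteq> X"
    using op assms by (auto simp: eventually_at_topological)
  have bl: "bounded_linear (\<lambda>H. - (?i X ** H ** ?i X))"
    by (intro bounded_linear_minus bounded_linear_compose[OF bounded_bilinear.bounded_linear_left[OF mm] bounded_bilinear.bounded_linear_right[OF mm]])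
  have bound: "norm ((?i Y - ?i X) - - (?i X ** (Y - X) ** ?i X)) / norm (Y - X)
      \<le> K * K * norm (?i X) * norm (?i X - ?i Y)" if "det Y \<noteq> 0 \<and> Y \<noteq> X" for Y
  proof -
    have "?i Y ** (Y - X) ** ?i X = ?i X - ?i Y"
      using that assms by (simp add: mm_diff matrix_inv_both matrix_mul_assoc)
         (simp add: matrix_mul_assoc[symmetric] matrix_inv_both)
    then have "(?i Y - ?i X) - - (?i X ** (Y - X) ** ?i X) = (?i X - ?i Y) ** (Y - X) ** ?i X"
      by (simp only: matrix_mult_diff_left) simp
    also have "norm \<dots> \<le> (norm (?i X - ?i Y) * norm (Y - X) * K) * norm (?i X) * K"
      using K(1) by (intro order_trans[OF K(2)[rule_format]] mult_right_mono K(2)[rule_format]) auto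
    finally show ?thesis using that by (simp add: divide_simps mult_ac)
  qed
  have "((\<lambda>Y. norm ((?i Y - ?i X) - - (?i X ** (Y - X) ** ?i X)) / norm (Y - X)) \<longlongrightarrow> 0) (at X within S)"
  proof (rule tendsto_sandwich[OF _ _ tendsto_const])
    show "\<forall>\<^sub>F Y in at X within S. norm ((?i Y - ?i X) - - (?i X ** (Y - X) ** ?i X)) / norm (Y - X)
      \<le> K * K * norm (?i X) * norm (?i X - ?i Y)"
      using ev by (rule eventually_mono) (rule bound)
    have "((\<lambda>Y. K * K * norm (?i X) * norm (?i X - ?i Y)) \<longlongrightarrow> K * K * norm (?i X) * norm (?i X - ?i X)) (at X within S)"
      by (intro tendsto_intros lim)
    then show "((\<lambda>Y. K * K * norm (?i X) * norm (?i X - ?i Y)) \<longlongrightarrow> 0) (at X within S)" by simp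
  qed simp
  with bl show ?thesis by (simp add: has_derivative_iff_norm)
qed


text \<open>The inverse of \<open>W ** matrix_inv U ** W\<close> is
  \<open>matrix_inv W ** U ** matrix_inv W\<close>, and the outer factors \<open>W\<close>
  cancel.\<close>

lemma inversion_involution:
  fixes W U :: "real^'n::finite^'n"
  assumes "det W \<noteq> 0" "det U \<noteq> 0"
  shows "W ** matrix_inv (W ** matrix_inv U ** W) ** W = U"
proof -
  let ?V = "matrix_inv W" and ?u = "matrix_inv U"
  have "(W ** ?u ** W) ** (?V ** U ** ?V) = W ** ?u ** (W ** ?V) ** U ** ?V"
    by (simp add: matrix_mul_assoc)
  also have "\<dots> = W ** ?u ** U ** ?V"
    by (simp add: matrix_inv_both assms)
  also have "\<dots> = W ** (?u ** U) ** ?V"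
    by (simp only: matrix_mul_assoc)
  also have "\<dots> = mat 1" by (simp add: matrix_inv_both assms)
  finally have "matrix_inv (W ** ?u ** W) = ?V ** U ** ?V" by (rule matrix_inv_unique)
  then have "W ** matrix_inv (W ** ?u ** W) ** W = (W ** ?V) ** U ** (?V ** W)"
    by (simp add: matrix_mul_assoc)
  then show ?thesis by (simp add: matrix_inv_both assms)
qed

lemma posdef_inversion:
  assumes "posdef W" "posdef U"
  shows "posdef (W ** matrix_inv U ** W)"
  using posdef_congruence[OF posdef_matrix_inv[OF assms(2)] posdef_det_nz[OF assms(1)]]
  by (simp add: posdefD(1)[OF assms(1)])

lemma borel_measurable_matrix_inv_posdef:
  "(\<lambda>U :: real^'p::{finite,linorder}^'p::{finite,linorder}. if posdef U then matrix_inv U else 0) \<in> borel_measurable borel"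
proof -
  have "(\<lambda>U. if U \<in> {U :: real^'p::{finite,linorder}^'p::{finite,linorder}. posdef U} then matrix_inv U else 0)
    \<in> borel_measurable borel"
    by (intro borel_measurable_continuous_on_if posdef_borel continuous_on_matrix_inv continuous_on_id continuous_on_const)
       (auto dest: posdef_det_nz)
  then show ?thesis by simp
qed

lemma borel_measurable_det [measurable]: "det \<in> borel_measurable (borel :: (real^'n::finite^'n) measure)"
  by (intro borel_measurable_continuous_onI continuous_intros)

lemma borel_measurable_matrix_mult [measurable (raw)]:
  fixes f :: "'a \<Rightarrow> real^'n::finite^'m::finite" and g :: "'a \<Rightarrow> real^'k::finite^'n"
  assumes "f \<in> borel_measurable M" "g \<in> borel_measurable M"
  shows "(\<lambda>x. f x ** g x) \<in> borel_measurable M"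
  using assms by (rule borel_measurable_continuous_Pair) (intro continuous_intros)

lemma has_derivative_inversion_coords:
  fixes W :: "real^'p::{finite,linorder}^'p::{finite,linorder}"
  assumes W: "posdef W" and y: "posdef (mat_of y)"
  shows "((\<lambda>y. lower_of (W ** matrix_inv (mat_of y) ** W)) has_derivative
    (\<lambda>h. - congr_map (W ** matrix_inv (mat_of y)) h)) (at y within S)"
proof -
  note mm = bounded_bilinear_matrix_mult
  have "((\<lambda>y. matrix_inv (mat_of y)) has_derivative
      (\<lambda>h. - (matrix_inv (mat_of y) ** mat_of h ** matrix_inv (mat_of y)))) (at y within S)"
    by (rule has_derivative_compose[OF bounded_linear_imp_has_derivative[OF bounded_linear_mat_of]
          has_derivative_matrix_inv[OF posdef_det_nz[OF y]]])
  then have "((\<lambda>y. lower_of (W ** matrix_inv (mat_of y) ** W)) has_derivative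
      (\<lambda>h. lower_of (W ** - (matrix_inv (mat_of y) ** mat_of h ** matrix_inv (mat_of y)) ** W))) (at y within S)"
    by (intro bounded_linear.has_derivative[OF bounded_linear_lower_of]
       bounded_linear.has_derivative[OF bounded_bilinear.bounded_linear_left[OF mm]]
       bounded_linear.has_derivative[OF bounded_bilinear.bounded_linear_right[OF mm]])
  moreover have "lower_of (W ** - (matrix_inv (mat_of y) ** mat_of h ** matrix_inv (mat_of y)) ** W)
      = - congr_map (W ** matrix_inv (mat_of y)) h" for h
    by (simp add: congr_map_def matrix_transpose_mul posdefD(1)[OF W] posdefD(1)[OF posdef_matrix_inv[OF y]]
        bounded_bilinear.minus_left[OF mm] bounded_bilinear.minus_right[OF mm] matrix_mul_assoc
        linear_neg[OF bounded_linear.linear[OF bounded_linear_lower_of]])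
  ultimately show ?thesis by simp
qed

lemma abs_det_matrix_uminus:
  fixes f :: "real^'n::finite \<Rightarrow> real^'n"
  assumes "linear f"
  shows "\<bar>det (matrix (\<lambda>x. - f x))\<bar> = \<bar>det (matrix f)\<bar>"
proof -
  have "matrix (\<lambda>x. - f x) = matrix (uminus \<circ> f)" by (simp add: o_def)
  also have "\<dots> = matrix uminus ** matrix f"
    by (rule matrix_compose[OF assms]) (simp add: linear_iff)
  also have "\<bar>det \<dots>\<bar> = \<bar>det (matrix uminus :: real^'n^'n)\<bar> * \<bar>det (matrix f)\<bar>"
    by (simp add: det_mul abs_mult)
  also have "det (matrix uminus :: real^'n::finite^'n) = (- 1) ^ CARD('n)"
    by (subst det_diagonal) (auto simp: matrix_def axis_def)
  finally show ?thesis by (simp add: power_abs)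
qed


text \<open>The image theorem for differentiable injections measures one set at a time. It is read
  as the equality of two measures, Lebesgue measure on the cone and the image under
  \<open>T'\<close> of \<open>J\<close> times that measure; the rule for integrals follows.\<close>

lemma nn_integral_inversion_coords:
  fixes W :: "real^'p::{finite,linorder}^'p::{finite,linorder}"
    and F :: "real^('p::{finite,linorder}) lowidx \<Rightarrow> ennreal"
  assumes W: "posdef W" and F: "F \<in> borel_measurable borel"
  defines "P \<equiv> {y. posdef (mat_of y)}"
    and "T \<equiv> \<lambda>y. lower_of (W ** matrix_inv (mat_of y) ** W)"
    and "J \<equiv> \<lambda>y. (det W / det (mat_of y)) ^ (CARD('p) + 1)"
  shows "(\<integral>\<^sup>+ y. F y * indicator P y \<partial>lborel) = (\<integral>\<^sup>+ y. F (T y) * ennreal (J y) * indicator P y \<partial>lborel)"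
proof -
  \<comment> \<open>Equal to \<open>T\<close> on the cone, and Borel on the whole space because the
    guard fixes the inverse elsewhere.\<close>
  define T' where "T' = (\<lambda>y. lower_of (W ** (if posdef (mat_of y) then matrix_inv (mat_of y) else 0) ** W))"
  have T'_eq: "T' y = T y" if "y \<in> P" for y using that by (simp add: T'_def T_def P_def)
  have mT: "mat_of (T y) = W ** matrix_inv (mat_of y) ** W" if "y \<in> P" for y
    unfolding T_def by (rule mat_of_lower_of, rule posdefD) (use that W posdef_inversion in \<open>auto simp: P_def\<close>)
  have TP: "T y \<in> P" if "y \<in> P" for y
    using posdef_inversion[OF W] mT[OF that] that by (simp add: P_def)
  have TT: "T (T y) = y" if "y \<in> P" for y
  proof -
    have "T (T y) = lower_of (W ** matrix_inv (mat_of (T y)) ** W)"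
      by (subst T_def) (rule refl)
    also have "\<dots> = lower_of (mat_of y)"
      unfolding mT[OF that] using inversion_involution[OF posdef_det_nz[OF W], of "mat_of y"] that posdef_det_nz[of "mat_of y"]
      by (simp add: P_def)
    finally show ?thesis by simp
  qed
  have meas_P [measurable]: "P \<in> sets borel" unfolding P_def by (intro borel_open open_posdef_coords)
  have meas_T' [measurable]: "T' \<in> borel_measurable borel"
    unfolding T'_def
    using measurable_compose[OF borel_measurable_mat_of borel_measurable_matrix_inv_posdef] by measurable
  have meas_J [measurable]: "J \<in> borel_measurable borel" unfolding J_def by measurable
  \<comment> \<open>Boundedness makes the measure of \<open>B \<inter> P\<close> finite, so that it
    can be the value of a real integral.\<close>
  have bounded_case: "emeasure lborel (B \<inter> P) = (\<integral>\<^sup>+ y. ennreal (J y) * indicator (P \<inter> T' -` B) y \<partial>lborel)"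
    if B: "B \<in> sets borel" "bounded B" for B
  proof -
    let ?S = "P \<inter> T' -` B"
    have S: "?S \<in> sets borel"
      using measurable_sets[OF meas_T' B(1)] by (intro sets.Int meas_P) simp
    \<comment> \<open>Since \<open>T\<close> is its own inverse on \<open>P\<close>, the preimage of
      \<open>B\<close> is carried exactly onto \<open>B \<inter> P\<close>.\<close>
    have im: "T ` ?S = B \<inter> P"
    proof
      show "T ` ?S \<subseteq> B \<inter> P" using TP T'_eq by auto
      show "B \<inter> P \<subseteq> T ` ?S"
      proof
        fix x assume x: "x \<in> B \<inter> P"
        then have "T x \<in> ?S" using TP TT T'_eq[of "T x"] by auto
        then show "x \<in> T ` ?S" using TT[of x] x by (intro image_eqI[of _ _ "T x"]) auto
      qed
    qed
    have BP: "B \<inter> P \<in> sets borel" using B meas_P by (intro sets.Int)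
    have lm: "B \<inter> P \<in> lmeasurable"
      using BP B(2) by (intro bounded_set_imp_lmeasurable) (auto intro: bounded_subset)
    have der: "(T has_derivative (\<lambda>h. - congr_map (W ** matrix_inv (mat_of y)) h)) (at y within ?S)" if "y \<in> ?S" for y
      unfolding T_def using has_derivative_inversion_coords[OF W] that by (simp add: P_def)
    have inj: "inj_on T ?S" by (rule inj_on_inverseI[of _ T]) (use TT in auto)
    have det: "\<bar>det (matrix (\<lambda>h. - congr_map (W ** matrix_inv (mat_of y)) h))\<bar> = J y" if "y \<in> ?S" for y
    proof -
      have p: "posdef (mat_of y)" using that by (simp add: P_def)
      have nz: "det (W ** matrix_inv (mat_of y)) \<noteq> 0"
        using posdef_det_nz[OF W] posdef_det_nz[OF p] by (simp add: det_mul det_matrix_inv)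
      have "\<bar>det (matrix (\<lambda>h. - congr_map (W ** matrix_inv (mat_of y)) h))\<bar>
          = congr_det (W ** matrix_inv (mat_of y))"
        unfolding congr_det_def by (rule abs_det_matrix_uminus[OF linear_congr_map])
      also have "\<dots> = \<bar>det W * inverse (det (mat_of y))\<bar> ^ (CARD('p) + 1)"
        using posdef_det_nz[OF p] congr_det_eq[OF nz] by (simp add: det_mul det_matrix_inv)
      also have "\<dots> = J y"
        using posdef_det_pos[OF p] posdef_det_pos[OF W] unfolding J_def by (simp add: divide_inverse)
      finally show ?thesis .
    qed
    have "((\<lambda>y. \<bar>det (matrix (\<lambda>h. - congr_map (W ** matrix_inv (mat_of y)) h))\<bar>) has_integral measure lebesgue (B \<inter> P)) ?S"
      using has_measure_differentiable_image[OF _ der inj, of "measure lebesgue (B \<inter> P)"] lm S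
      unfolding im by simp
    then have "(J has_integral measure lebesgue (B \<inter> P)) ?S"
      by (rule has_integral_eq[rotated]) (use det in auto)
    moreover have "J y \<ge> 0" if "y \<in> ?S" for y using det[OF that] by (metis abs_ge_zero)
    ultimately have "(\<integral>\<^sup>+ y. ennreal (J y) * indicator ?S y \<partial>lborel) = ennreal (measure lebesgue (B \<inter> P))"
      by (intro nn_integral_has_integral_lebesgue') auto
    also have "\<dots> = emeasure lebesgue (B \<inter> P)"
      by (rule emeasure_eq_ennreal_measure[symmetric]) (use fmeasurableD2[OF lm] in simp)
    also have "\<dots> = emeasure lborel (B \<inter> P)" using BP by simp
    finally show ?thesis by simp
  qed
  define M1 where "M1 = density lborel (indicator P)"
  define M2 where "M2 = distr (density lborel (\<lambda>y. ennreal (J y) * indicator P y)) borel T'"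
  have M1: "emeasure M1 B = emeasure lborel (B \<inter> P)" if "B \<in> sets borel" for B
  proof -
    have "emeasure M1 B = (\<integral>\<^sup>+ y. indicator P y * indicator B y \<partial>lborel)"
      using that unfolding M1_def by (intro emeasure_density) simp_all
    also have "\<dots> = (\<integral>\<^sup>+ y. indicator (B \<inter> P) y \<partial>lborel)"
      by (intro nn_integral_cong) (simp split: split_indicator)
    also have "\<dots> = emeasure lborel (B \<inter> P)"
      using that by (intro nn_integral_indicator) (simp add: sets.Int)
    finally show ?thesis .
  qed
  have M2: "emeasure M2 B = (\<integral>\<^sup>+ y. ennreal (J y) * indicator (P \<inter> T' -` B) y \<partial>lborel)" if B: "B \<in> sets borel" for B
  proof -
    have "T' -` B \<in> sets borel" using measurable_sets[OF meas_T' B] by simp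
    then have "emeasure M2 B = (\<integral>\<^sup>+ y. ennreal (J y) * indicator P y * indicator (T' -` B) y \<partial>lborel)"
      using B unfolding M2_def by (simp add: emeasure_distr emeasure_density)
    also have "\<dots> = (\<integral>\<^sup>+ y. ennreal (J y) * indicator (P \<inter> T' -` B) y \<partial>lborel)"
      by (intro nn_integral_cong) (simp split: split_indicator)
    finally show ?thesis .
  qed
  have "M1 = M2"
  proof (rule measure_eqI)
    show s: "sets M1 = sets M2" by (simp add: M1_def M2_def)
    fix A assume "A \<in> sets M1"
    then have A: "A \<in> sets borel" by (simp add: M1_def)
    \<comment> \<open>Exhaustion by balls lifts the restriction to bounded sets.\<close>
    define B where "B = (\<lambda>n::nat. A \<inter> ball 0 (real n))"
    have B: "B n \<in> sets borel" "bounded (B n)" for n using A by (auto simp: B_def)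
    have incB: "incseq B" by (auto simp: B_def incseq_def)
    have UB: "(\<Union>n. B n) = A" by (auto simp: B_def reals_Archimedean2)
    have "emeasure M1 (B n) = emeasure M2 (B n)" for n
      using bounded_case[OF B] M1[OF B(1)] M2[OF B(1)] by simp
    then have "(SUP n. emeasure M1 (B n)) = (SUP n. emeasure M2 (B n))" by simp
    then show "emeasure M1 A = emeasure M2 A"
      using B(1) incB by (subst (asm) (1 2) SUP_emeasure_incseq) (auto simp: M1_def M2_def UB)
  qed
  have "(\<integral>\<^sup>+ y. F y * indicator P y \<partial>lborel) = (\<integral>\<^sup>+ y. F y \<partial>M1)"
    using F by (simp add: M1_def nn_integral_density mult.commute)
  also have "\<dots> = (\<integral>\<^sup>+ y. F y \<partial>M2)" by (simp add: \<open>M1 = M2\<close>)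
  also have "\<dots> = (\<integral>\<^sup>+ y. ennreal (J y) * indicator P y * F (T' y) \<partial>lborel)"
    using F unfolding M2_def by (simp add: nn_integral_distr nn_integral_density)
  also have "\<dots> = (\<integral>\<^sup>+ y. F (T y) * ennreal (J y) * indicator P y \<partial>lborel)"
    by (intro nn_integral_cong) (auto simp: T'_eq mult_ac split: split_indicator)
  finally show ?thesis .
qed

theorem nn_integral_inversion:
  fixes W :: "real^'p::{finite,linorder}^'p::{finite,linorder}"
    and F :: "real^'p::{finite,linorder}^'p::{finite,linorder} \<Rightarrow> ennreal"
  assumes W: "posdef W" and F: "F \<in> borel_measurable borel"
  shows "(\<integral>\<^sup>+ X. F X * indicator {X. posdef X} X \<partial>sym_lebesgue)
    = (\<integral>\<^sup>+ U. F (W ** matrix_inv U ** W) * ennreal ((det W / det U) ^ (CARD('p) + 1)) * indicator {U. posdef U} U \<partial>sym_lebesgue)"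
proof -
  let ?iF = "\<lambda>U. F (W ** (if posdef U then matrix_inv U else 0) ** W) * ennreal ((det W / det U) ^ (CARD('p) + 1)) * indicator {U. posdef U} U"
  have [measurable]: "?iF \<in> borel_measurable borel"
    using F borel_measurable_matrix_inv_posdef posdef_borel by measurable
  have [measurable]: "(\<lambda>X. F X * indicator {X. posdef X} X) \<in> borel_measurable borel"
    using F posdef_borel by measurable
  have "(\<integral>\<^sup>+ U. F (W ** matrix_inv U ** W) * ennreal ((det W / det U) ^ (CARD('p) + 1)) * indicator {U. posdef U} U \<partial>sym_lebesgue)
     = (\<integral>\<^sup>+ U. ?iF U \<partial>sym_lebesgue)"
    by (intro nn_integral_cong) (auto split: split_indicator)
  also have "\<dots> = (\<integral>\<^sup>+ y. ?iF (mat_of y) \<partial>lborel)"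
    by (rule nn_integral_sym_lebesgue) measurable
  also have "\<dots> = (\<integral>\<^sup>+ y. F (mat_of (lower_of (W ** matrix_inv (mat_of y) ** W)))
       * ennreal ((det W / det (mat_of y)) ^ (CARD('p) + 1)) * indicator {y. posdef (mat_of y)} y \<partial>lborel)"
    using posdefD(1)[OF posdef_inversion[OF W]]
    by (intro nn_integral_cong) (auto simp: mat_of_lower_of split: split_indicator)
  also have "\<dots> = (\<integral>\<^sup>+ y. F (mat_of y) * indicator {y. posdef (mat_of y)} y \<partial>lborel)"
    by (rule nn_integral_inversion_coords[OF W, of "\<lambda>y. F (mat_of y)", symmetric]) (use F in measurable)
  also have "\<dots> = (\<integral>\<^sup>+ y. F (mat_of y) * indicator {X. posdef X} (mat_of y) \<partial>lborel)"
    by (intro nn_integral_cong) (auto split: split_indicator)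
  also have "\<dots> = (\<integral>\<^sup>+ X. F X * indicator {X. posdef X} X \<partial>sym_lebesgue)"
    by (rule nn_integral_sym_lebesgue[symmetric]) measurable
  finally show ?thesis by simp
qed

subsection \<open>The beta density and the Kober kernel\<close>

text \<open>In exponential form, identities between powers become linear in the logarithms, and
  continuity and measurability can be read off.\<close>

lemma cpow_exp: "d > 0 \<Longrightarrow> cpow d s = exp (s * of_real (ln d))"
  by (simp add: cpow_def powr_def Ln_of_real)

text \<open>\<open>Gamma\<close> takes the value 0 exactly at its poles, by convention. The largest
  shift is \<open>(p - 1) / 2\<close>, so every argument keeps a positive real part and avoids
  them.\<close>

lemma mgamma_nonzero:
  assumes "Re a > (real p - 1) / 2"
  shows "mgamma p a \<noteq> 0"
proof -
  have "Gamma (a - complex_of_real (real i / 2)) \<noteq> 0" if "i < p" for i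
  proof -
    have "real i \<le> real p - 1" using that by linarith
    then have "Re (a - complex_of_real (real i / 2)) > 0" using assms by simp
    then have "a - complex_of_real (real i / 2) \<notin> \<int>\<^sub>\<le>\<^sub>0"
      by (metis Re_complex_of_real nonpos_Ints_cases not_le of_int_le_0_iff of_real_of_int_eq)
    then show ?thesis by (simp add: Gamma_eq_zero_iff)
  qed
  then show ?thesis by (auto simp: mgamma_def)
qed

lemma mgamma_add_nonzero:
  assumes "Re z > (real p - 1) / 2" "Re a > (real p - 1) / 2" "p \<ge> 1"
  shows "mgamma p (z + a) \<noteq> 0"
proof (rule mgamma_nonzero)
  have "(real p - 1) / 2 \<ge> 0" using assms(3) by simp
  then show "Re (z + a) > (real p - 1) / 2" unfolding plus_complex.sel using assms(1,2) by linarith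
qed

text \<open>Moving \<open>W\<close> across gives \<open>W ** (mat 1 - W ** matrix_inv U ** W) = (mat
  1 - W ** W ** matrix_inv U) ** W\<close>; cancel \<open>det W\<close>, then absorb
  \<open>U\<close> from the right.\<close>

lemma det_one_minus_inversion:
  fixes W V :: "real^'n::finite^'n"
  assumes "posdef W" "posdef U"
  shows "det (mat 1 - W ** matrix_inv U ** W) * det U = det (U - W ** W)"
proof -
  note W = posdef_det_nz[OF assms(1)] and U = posdef_det_nz[OF assms(2)]
  have "W ** (mat 1 - W ** matrix_inv U ** W) = (mat 1 - W ** W ** matrix_inv U) ** W"
    by (simp only: matrix_mult_diff_left matrix_mult_diff_right) (simp add: matrix_mul_assoc)
  then have "det W * det (mat 1 - W ** matrix_inv U ** W) = det (mat 1 - W ** W ** matrix_inv U) * det W"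
    by (metis det_mul)
  then have "det (mat 1 - W ** matrix_inv U ** W) = det (mat 1 - W ** W ** matrix_inv U)"
    using W by simp
  also have "\<dots> * det U = det ((mat 1 - W ** W ** matrix_inv U) ** U)" by (simp add: det_mul)
  also have "(mat 1 - W ** W ** matrix_inv U) ** U = U - W ** W ** (matrix_inv U ** U)"
    by (simp only: matrix_mult_diff_left) (simp add: matrix_mul_assoc)
  finally show ?thesis by (simp add: matrix_inv_both[OF U])
qed

text \<open>\<^term>\<open>A\<close> and its transpose have the same operator norm.\<close>

lemma posdef_one_minus_gram:
  fixes A :: "real^'n::finite^'n"
  assumes "posdef (mat 1 - A ** transpose A)"
  shows "posdef (mat 1 - transpose A ** A)"
  unfolding posdef_def symmetric_mat_def
proof (intro conjI allI impI)
  show "transpose (mat 1 - transpose A ** A) = mat 1 - transpose A ** A"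
    by (simp add: transpose_diff transpose_mat matrix_transpose_mul)
  fix x :: "real^'n" assume x: "x \<noteq> 0"
  define y where "y = A *v x"
  define w where "w = transpose A *v y"
  have xw: "x \<bullet> w = y \<bullet> y"
    unfolding w_def y_def by (simp add: dot_matrix_mult transpose_transpose del: transpose_matrix_vector)
  have eq: "x \<bullet> ((mat 1 - transpose A ** A) *v x) = x \<bullet> x - y \<bullet> y"
    using xw unfolding w_def y_def
    by (simp add: matrix_vector_mult_diff_rdistrib inner_diff_right matrix_vector_mul_assoc del: transpose_matrix_vector)
  show "x \<bullet> ((mat 1 - transpose A ** A) *v x) > 0"
  proof (cases "y = 0")
    case True
    then show ?thesis using x eq by simp
  next
    case False
    have "y \<bullet> ((mat 1 - A ** transpose A) *v y) = y \<bullet> y - w \<bullet> w"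
      by (simp add: w_def matrix_vector_mult_diff_rdistrib inner_diff_right matrix_vector_mul_assoc[symmetric]
           dot_matrix_mult[of y A] del: transpose_matrix_vector)
    then have ww: "w \<bullet> w < y \<bullet> y" using posdefD(2)[OF assms False] by simp
    have "(y \<bullet> y)\<^sup>2 \<le> (x \<bullet> x) * (w \<bullet> w)"
      using Cauchy_Schwarz_ineq[of x w] xw by simp
    also have "\<dots> < (x \<bullet> x) * (y \<bullet> y)" using ww x by simp
    finally have "y \<bullet> y < x \<bullet> x" using False by (simp add: power2_eq_square)
    then show ?thesis using eq by simp
  qed
qed

text \<open>With \<open>R\<close> the root of \<open>U\<close> and
  \<open>A = W ** matrix_inv R\<close>, the left matrix is \<open>A ** transpose A\<close>, while
  \<open>U - W ** W\<close> is congruent by \<open>R\<close> to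
  \<open>mat 1 - transpose A ** A\<close>. The preceding lemma exchanges the two orders.\<close>

lemma mat_less_one_inversion_iff:
  fixes W U :: "real^'p::{finite,linorder}^'p::{finite,linorder}"
  assumes W: "posdef W" and U: "posdef U"
  shows "mat_less (W ** matrix_inv U ** W) (mat 1) \<longleftrightarrow> mat_less (W ** W) U"
proof -
  define R where "R = msqrt U"
  have R: "posdef R" "R ** R = U" using posdef_msqrt[OF U] msqrt_square[OF U] by (auto simp: R_def)
  define r where "r = matrix_inv R"
  note Rr = matrix_inv_both[OF posdef_det_nz[OF R(1)], folded r_def]
  have r: "posdef r" unfolding r_def by (rule posdef_matrix_inv[OF R(1)])
  have "U ** (r ** r) = R ** (R ** r) ** r" by (simp add: R(2)[symmetric] matrix_mul_assoc)
  then have iU: "matrix_inv U = r ** r" by (intro matrix_inv_unique) (simp add: Rr)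
  define A where "A = W ** r"
  have tA: "transpose A = r ** W" by (simp add: A_def matrix_transpose_mul posdefD(1)[OF W] posdefD(1)[OF r])
  have "W ** matrix_inv U ** W = A ** transpose A"
    unfolding tA iU by (simp add: A_def matrix_mul_assoc)
  moreover have "R ** (mat 1 - transpose A ** A) ** transpose R = U - W ** W"
  proof -
    have "R ** (mat 1 - transpose A ** A) ** transpose R = R ** R - R ** (transpose A ** A) ** R"
      unfolding posdefD(1)[OF R(1)]
      by (simp only: matrix_mult_diff_left matrix_mult_diff_right) simp
    also have "R ** (transpose A ** A) ** R = (R ** r) ** W ** W ** (r ** R)"
      unfolding tA unfolding A_def by (simp add: matrix_mul_assoc)
    finally show ?thesis by (simp add: Rr R(2))
  qed
  ultimately show ?thesis
    using posdef_congruence_iff[OF posdef_det_nz[OF R(1)], of "mat 1 - transpose A ** A"]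
      posdef_one_minus_gram[of A] posdef_one_minus_gram[of "transpose A"]
    by (auto simp: mat_less_def)
qed

text \<open>The conditional density of \<open>U j\<close> at \<open>u\<close> given that
  \<open>V j\<close> is \<open>v\<close>, with the normalising constant of the beta density.\<close>

definition kober_kernel :: "complex \<Rightarrow> complex \<Rightarrow> real^'p::finite^'p \<Rightarrow> real^'p::finite^'p \<Rightarrow> complex" where
  "kober_kernel z a v u =
    (if posdef v \<and> mat_less v u then
       mgamma CARD('p) (z + a) / (mgamma CARD('p) z * mgamma CARD('p) a) * cpow (det u) (- z - a) *
       (cpow (det v) z * cpow (det (u - v)) (a - of_real ((real CARD('p) + 1) / 2)))
     else 0)"

lemma mat_less_posdef: "posdef v \<Longrightarrow> mat_less v u \<Longrightarrow> posdef u"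
  using posdef_add[of v "u - v"] by (simp add: mat_less_def)

text \<open>A balance of exponents with \<open>h = (p + 1) / 2\<close>. The two beta factors and the
  Jacobian give \<open>det u\<close> the exponent
  \<open>- (z - h) - (a - h) - 2 * h = - z - a\<close>. The exponent of \<open>det W\<close> is
  \<open>2 * (z - h) + 2 * h = 2 * z\<close>, so that of \<open>det v\<close> is \<open>z\<close>,
  with no shift left.\<close>

lemma beta1_density_inversion:
  fixes v u :: "real^'p::{finite,linorder}^'p::{finite,linorder}"
  assumes v: "posdef v" and u: "posdef u"
  defines "W \<equiv> msqrt v"
  shows "beta1_density z a (W ** matrix_inv u ** W) * of_real ((det W / det u) ^ (CARD('p) + 1)) = kober_kernel z a v u"
proof -
  let ?x = "W ** matrix_inv u ** W"
  have W: "posdef W" "W ** W = v" unfolding W_def by (auto simp: posdef_msqrt msqrt_square v)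
  have x: "posdef ?x" by (rule posdef_inversion[OF W(1) u])
  have less: "mat_less ?x (mat 1) \<longleftrightarrow> mat_less v u"
    using mat_less_one_inversion_iff[OF W(1) u] by (simp add: W(2))
  show ?thesis
  proof (cases "mat_less v u")
    case False
    then show ?thesis by (simp add: beta1_density_def kober_kernel_def less Let_def)
  next
    case True
    define dW du dm where "dW = det W" and "du = det u" and "dm = det (u - v)"
    have pos: "dW > 0" "du > 0" "dm > 0"
      using posdef_det_pos[OF W(1)] posdef_det_pos[OF u] posdef_det_pos[of "u - v"] True
      by (auto simp: dW_def du_def dm_def mat_less_def)
    have dv: "det v = dW * dW" using W(2) by (metis det_mul dW_def)
    have dx: "det ?x = dW * dW / du"
      using posdef_det_nz[OF u] by (simp add: det_mul det_matrix_inv dW_def du_def divide_inverse)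
    have d1: "det (mat 1 - ?x) = dm / du"
      using det_one_minus_inversion[OF W(1) u] pos by (simp add: W(2) dm_def du_def field_simps)
    define h where "h = complex_of_real ((real CARD('p) + 1) / 2)"
    have pw: "complex_of_real ((dW / du) ^ (CARD('p) + 1)) = exp (2 * h * (of_real (ln dW) - of_real (ln du)))"
    proof -
      have "(dW / du) ^ (CARD('p) + 1) = exp (real (CARD('p) + 1) * (ln dW - ln du))"
        using pos by (subst exp_of_nat_mult) (simp add: exp_diff)
      moreover have "2 * h = of_real (real (CARD('p) + 1))" by (simp add: h_def)
      ultimately show ?thesis by (simp only: exp_of_real[symmetric] of_real_mult of_real_diff)
    qed
    have "cpow (dW * dW / du) (z - h) * cpow (dm / du) (a - h) * exp (2 * h * (of_real (ln dW) - of_real (ln du)))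
      = cpow du (- z - a) * (cpow (dW * dW) z * cpow dm (a - h))"
      using pos by (simp add: cpow_exp ln_mult ln_div exp_add[symmetric] algebra_simps)
    then show ?thesis
      using True x v unfolding beta1_density_def kober_kernel_def Let_def less pw[unfolded dW_def du_def] h_def[symmetric]
      by (simp add: dx d1 dv dm_def[symmetric] du_def[symmetric] dW_def[symmetric] mult.assoc)
  qed
qed


section \<open>Sign of the beta density and measurability of the kernel\<close>

lemma mat_of_lower_of_posdef: "posdef A \<Longrightarrow> mat_of (lower_of A) = A"
  by (intro mat_of_lower_of posdefD(1))

text \<open>Nonempty open sets are not null. This upgrades an almost everywhere property of a
  continuous function to every point.\<close>

lemma AE_lborel_open_empty:
  fixes N :: "'a::euclidean_space set"
  assumes "open N" "AE x in lborel. x \<notin> N"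
  shows "N = {}"
proof -
  have "N \<in> null_sets lborel"
    using assms by (subst AE_iff_null_sets) auto
  then have "negligible N" by (simp add: negligible_iff_null_sets null_sets_completionI)
  then show ?thesis using open_not_negligible[OF assms(1)] by blast
qed

text \<open>For complex parameters the beta density could a priori be negative. It is continuous and
  nowhere zero on a connected domain, so it would be negative everywhere, contradicting
  total mass one.\<close>

lemma (in prob_space) beta1_density_nonneg:
  fixes X :: "'a \<Rightarrow> real^'p::{finite,linorder}^'p::{finite,linorder}" and x :: "real^'p::{finite,linorder}^'p::{finite,linorder}"
  assumes a: "Re a > (real CARD('p) - 1) / 2" and z: "Re z > (real CARD('p) - 1) / 2"
    and X: "distributed M sym_lebesgue X (\<lambda>x. ennreal (d x))"
    and d: "AE x in sym_lebesgue. complex_of_real (d x) = beta1_density z a x"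
  shows "beta1_density z a x = of_real (Re (beta1_density z a x)) \<and> Re (beta1_density z a x) \<ge> 0"
proof -
  define b where "b = (\<lambda>y. beta1_density z a (mat_of y :: real^'p::{finite,linorder}^'p::{finite,linorder}))"
  define Y where "Y = {y. posdef (mat_of y :: real^'p::{finite,linorder}^'p::{finite,linorder})} \<inter> {y. posdef (mat 1 - mat_of y :: real^'p::{finite,linorder}^'p::{finite,linorder})}"
  have oY: "open Y"
    unfolding Y_def by (intro open_Int open_posdef_coords open_posdef_diff_coords) (simp add: transpose_mat)
  have cY: "connected Y"
    unfolding Y_def by (intro convex_connected convex_Int convex_posdef_coords convex_posdef_diff_coords)
  have b_exp: "b y = mgamma CARD('p) (z + a) / (mgamma CARD('p) z * mgamma CARD('p) a) *
      exp ((z - of_real ((real CARD('p) + 1) / 2)) * of_real (ln (det (mat_of y)))) *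
      exp ((a - of_real ((real CARD('p) + 1) / 2)) * of_real (ln (det (mat 1 - mat_of y))))" if "y \<in> Y" for y
  proof -
    have "posdef (mat_of y)" "posdef (mat 1 - mat_of y)" using that by (simp_all add: Y_def)
    then show ?thesis
      by (simp add: b_def beta1_density_def mat_less_def Let_def cpow_exp[OF posdef_det_pos])
  qed
  have b_0: "b y = 0" if "y \<notin> Y" for y
    using that by (auto simp: b_def beta1_density_def Y_def mat_less_def Let_def)
  have "mgamma CARD('p) (z + a) \<noteq> 0" using z a by (rule mgamma_add_nonzero) (simp add: Suc_leI)
  then have bnz: "b y \<noteq> 0" if "y \<in> Y" for y
    using mgamma_nonzero[OF a] mgamma_nonzero[OF z] by (simp add: b_exp[OF that])
  have cont: "continuous_on Y b"
  proof -
    have "det (mat_of y) \<noteq> 0" "det (mat 1 - mat_of y) \<noteq> 0" if "y \<in> Y" for y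
      using that by (auto simp: Y_def dest: posdef_det_nz)
    then have "continuous_on Y (\<lambda>y. mgamma CARD('p) (z + a) / (mgamma CARD('p) z * mgamma CARD('p) a) *
      exp ((z - of_real ((real CARD('p) + 1) / 2)) * of_real (ln (det (mat_of y)))) *
      exp ((a - of_real ((real CARD('p) + 1) / 2)) * of_real (ln (det (mat 1 - mat_of y)))))"
      by (intro continuous_intros) auto
    then show ?thesis by (rule continuous_on_eq) (simp add: b_exp)
  qed
  have "AE y in lborel. complex_of_real (d (mat_of y)) = b y"
    using AE_distrD[of mat_of lborel borel] d unfolding sym_lebesgue_eq b_def by simp
  note AE_b = this
  \<comment> \<open>The points of \<open>Y\<close> with a nonreal value form an open set by
    continuity and a null set because \<open>d\<close> is real.\<close>
  have real: "Im (b y) = 0" for y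
  proof -
    have "open (Y \<inter> (\<lambda>y. Im (b y)) -` (- {0}))"
      by (intro continuous_open_preimage oY continuous_on_Im cont) auto
    moreover have "AE y in lborel. y \<notin> Y \<inter> (\<lambda>y. Im (b y)) -` (- {0})"
      using AE_b by (rule AE_mp) (auto intro!: AE_I2 dest: arg_cong[of _ _ Im])
    ultimately have "Y \<inter> (\<lambda>y. Im (b y)) -` (- {0}) = {}" by (rule AE_lborel_open_empty)
    then show ?thesis using b_0[of y] by (cases "y \<in> Y") auto
  qed
  have pos: "Re (b y) \<ge> 0" for y
  proof (rule ccontr)
    assume neg: "\<not> Re (b y) \<ge> 0"
    then have y: "y \<in> Y" using b_0[of y] by fastforce
    have conn: "connected ((\<lambda>y. Re (b y)) ` Y)"
      by (intro connected_continuous_image cY continuous_intros cont)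
    have "Re (b y') \<le> 0" for y'
    proof (rule ccontr)
      assume pos: "\<not> Re (b y') \<le> 0"
      then have "y' \<in> Y" using b_0[of y'] by fastforce
      with y have "{Re (b y)..Re (b y')} \<subseteq> (\<lambda>y. Re (b y)) ` Y"
        by (intro connected_contains_Icc[OF conn]) auto
      then have "0 \<in> (\<lambda>y. Re (b y)) ` Y" using neg pos by auto
      then obtain y'' where "y'' \<in> Y" "Re (b y'') = 0" by auto
      then show False using bnz[of y''] real[of y''] by (simp add: complex_eq_iff)
    qed
    \<comment> \<open>\<open>ennreal\<close> sends negative reals to zero, so a density that is
      nowhere positive has total mass zero.\<close>
    then have "AE y in lborel. ennreal (d (mat_of y)) = 0"
      using AE_b by (auto elim!: eventually_mono simp: complex_eq_iff ennreal_eq_0_iff)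
    then have "(\<integral>\<^sup>+ y. ennreal (d (mat_of y)) \<partial>lborel) = (\<integral>\<^sup>+ y. 0 \<partial>(lborel :: (real^'p lowidx) measure))"
      by (rule nn_integral_cong_AE)
    moreover have [measurable]: "(\<lambda>x. ennreal (d x)) \<in> borel_measurable borel"
      using distributed_borel_measurable[OF X] by simp
    ultimately have "(\<integral>\<^sup>+ x. ennreal (d x) \<partial>sym_lebesgue) = 0"
      by (simp add: nn_integral_sym_lebesgue)
    moreover have "(\<integral>\<^sup>+ x. ennreal (d x) \<partial>sym_lebesgue) = 1"
      using distributed_emeasure[OF X, of UNIV] by (simp add: emeasure_space_1)
    ultimately show False by simp
  qed
  have "\<exists>r\<ge>0. beta1_density z a x = of_real r"
  proof (cases "posdef x")
    case True
    then have "beta1_density z a x = b (lower_of x)" by (simp add: b_def mat_of_lower_of_posdef)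
    then show ?thesis using real pos by (intro exI[of _ "Re (b (lower_of x))"]) (simp add: complex_eq_iff)
  next
    case False
    then show ?thesis by (intro exI[of _ 0]) (simp add: beta1_density_def Let_def)
  qed
  then show ?thesis by auto
qed

lemma measurable_posdef [measurable]:
  "Measurable.pred borel (posdef :: real^'p::{finite,linorder}^'p::{finite,linorder} \<Rightarrow> bool)"
  using posdef_borel by (simp add: pred_def)

lemma borel_measurable_beta1_density [measurable]:
  "beta1_density z a \<in> borel_measurable (borel :: (real^'p::{finite,linorder}^'p::{finite,linorder}) measure)"
proof -
  have "beta1_density z a = (\<lambda>x :: real^'p::{finite,linorder}^'p::{finite,linorder}. if posdef x \<and> posdef (mat 1 - x) then
      mgamma CARD('p) (z + a) / (mgamma CARD('p) z * mgamma CARD('p) a) *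
      exp ((z - of_real ((real CARD('p) + 1) / 2)) * of_real (ln (det x))) *
      exp ((a - of_real ((real CARD('p) + 1) / 2)) * of_real (ln (det (mat 1 - x)))) else 0)"
    by (rule ext) (simp add: beta1_density_def mat_less_def Let_def cpow_exp[OF posdef_det_pos])
  also have "\<dots> \<in> borel_measurable borel" by measurable
  finally show ?thesis .
qed

lemma borel_measurable_kober_kernel [measurable (raw)]:
  fixes f g :: "'a \<Rightarrow> real^'p::{finite,linorder}^'p::{finite,linorder}"
  assumes [measurable]: "f \<in> borel_measurable M" "g \<in> borel_measurable M"
  shows "(\<lambda>x. kober_kernel z a (f x) (g x)) \<in> borel_measurable M"
proof -
  have "kober_kernel z a (f x) (g x) = (if posdef (f x) \<and> posdef (g x - f x) then
      mgamma CARD('p) (z + a) / (mgamma CARD('p) z * mgamma CARD('p) a) *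
      exp ((- z - a) * of_real (ln (det (g x)))) * (exp (z * of_real (ln (det (f x)))) *
      exp ((a - of_real ((real CARD('p) + 1) / 2)) * of_real (ln (det (g x - f x))))) else 0)" for x
    using mat_less_posdef[of "f x" "g x"]
    by (simp add: kober_kernel_def mat_less_def cpow_exp[OF posdef_det_pos])
  then show ?thesis by simp
qed

section \<open>The conditional law of one matrix\<close>

text \<open>Inherited from the beta density, from which the kernel differs by a positive Jacobian
  factor.\<close>

lemma kober_kernel_nonneg:
  fixes v u :: "real^'p::{finite,linorder}^'p::{finite,linorder}"
  assumes b: "\<And>x :: real^'p::{finite,linorder}^'p::{finite,linorder}.
    beta1_density z a x = of_real (Re (beta1_density z a x)) \<and> Re (beta1_density z a x) \<ge> 0"
  shows "kober_kernel z a v u = of_real (Re (kober_kernel z a v u))" "Re (kober_kernel z a v u) \<ge> 0"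
proof -
  have "\<exists>r\<ge>0. kober_kernel z a v u = of_real r"
  proof (cases "posdef v \<and> mat_less v u")
    case True
    then have v: "posdef v" and u: "posdef u" using mat_less_posdef by auto
    let ?x = "msqrt v ** matrix_inv u ** msqrt v"
    let ?J = "(det (msqrt v) / det u) ^ (CARD('p) + 1)"
    have "kober_kernel z a v u = of_real (Re (beta1_density z a ?x) * ?J)"
      using beta1_density_inversion[OF v u, of z a] b[of ?x] by (metis of_real_mult)
    moreover have "?J \<ge> 0"
      using posdef_det_pos[OF posdef_msqrt[OF v]] posdef_det_pos[OF u] by (intro zero_le_power) simp
    ultimately show ?thesis using b[of ?x] by (metis mult_nonneg_nonneg)
  qed (auto simp: kober_kernel_def)
  then show "kober_kernel z a v u = of_real (Re (kober_kernel z a v u))" "Re (kober_kernel z a v u) \<ge> 0"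
    by auto
qed

text \<open>The guards make this map Borel measurable: \<^const>\<open>msqrt\<close> and \<^const>\<open>matrix_inv\<close> have
  arbitrary values outside the cone.\<close>

definition inv_sandwich :: "real^'p::{finite,linorder}^'p::{finite,linorder} \<Rightarrow> real^'p::{finite,linorder}^'p::{finite,linorder} \<Rightarrow> real^'p::{finite,linorder}^'p::{finite,linorder}" where
  "inv_sandwich v x = (if posdef v then msqrt v else 0) ** (if posdef x then matrix_inv x else 0) ** (if posdef v then msqrt v else 0)"

lemma borel_measurable_inv_sandwich [measurable (raw)]:
  fixes f g :: "'a \<Rightarrow> real^'p::{finite,linorder}^'p::{finite,linorder}"
  assumes f: "f \<in> borel_measurable M" and g: "g \<in> borel_measurable M"
  shows "(\<lambda>x. inv_sandwich (f x) (g x)) \<in> borel_measurable M"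
proof -
  have "(\<lambda>v. if v \<in> {v :: real^'p::{finite,linorder}^'p::{finite,linorder}. posdef v} then msqrt v else 0) \<in> borel_measurable borel"
    by (intro borel_measurable_continuous_on_if posdef_borel continuous_on_msqrt continuous_on_const)
  then have 1: "(\<lambda>v :: real^'p::{finite,linorder}^'p::{finite,linorder}. if posdef v then msqrt v else 0) \<in> borel_measurable borel"
    by simp
  show ?thesis
    unfolding inv_sandwich_def
    by (intro borel_measurable_matrix_mult measurable_compose[OF f 1] measurable_compose[OF g borel_measurable_matrix_inv_posdef])
qed

text \<open>On the cone \<open>inv_sandwich v\<close> is an involution, so the substitution restores
  the bare \<open>u\<close> inside the indicator, and the beta density times the Jacobian becomes
  the kernel.\<close>

lemma distr_inv_sandwich:
  fixes v :: "real^'p::{finite,linorder}^'p::{finite,linorder}"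
  assumes b: "\<And>x :: real^'p::{finite,linorder}^'p::{finite,linorder}.
    beta1_density z a x = of_real (Re (beta1_density z a x)) \<and> Re (beta1_density z a x) \<ge> 0"
    and v: "posdef v"
  shows "distr (density sym_lebesgue (\<lambda>x. ennreal (Re (beta1_density z a x)))) sym_lebesgue (inv_sandwich v)
    = density sym_lebesgue (\<lambda>u. ennreal (Re (kober_kernel z a v u)))" (is "?L = ?R")
proof (rule measure_eqI)
  let ?b = "\<lambda>x. ennreal (Re (beta1_density z a x))"
  let ?P = "{x :: real^'p::{finite,linorder}^'p::{finite,linorder}. posdef x}"
  fix A assume "A \<in> sets ?L"
  then have A [measurable]: "A \<in> sets borel" by simp
  define W where "W = msqrt v"
  have W: "posdef W" unfolding W_def by (rule posdef_msqrt[OF v])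
  have m [measurable]: "inv_sandwich v \<in> borel_measurable borel" by measurable
  have "emeasure ?L A = (\<integral>\<^sup>+ x. indicator A x \<partial>?L)" by simp
  also have "\<dots> = (\<integral>\<^sup>+ x. ?b x * indicator A (inv_sandwich v x) \<partial>sym_lebesgue)"
    by (subst nn_integral_distr) (simp_all add: nn_integral_density)
  \<comment> \<open>The beta density vanishes off the cone, so the indicator required by the
    substitution rule can be inserted.\<close>
  also have "\<dots> = (\<integral>\<^sup>+ x. (?b x * indicator A (inv_sandwich v x)) * indicator ?P x \<partial>sym_lebesgue)"
    by (intro nn_integral_cong) (auto simp: beta1_density_def Let_def split: split_indicator)
  also have "\<dots> = (\<integral>\<^sup>+ u. (?b (W ** matrix_inv u ** W) * indicator A (inv_sandwich v (W ** matrix_inv u ** W)))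
      * ennreal ((det W / det u) ^ (CARD('p) + 1)) * indicator ?P u \<partial>sym_lebesgue)"
    by (rule nn_integral_inversion[OF W]) measurable
  also have "\<dots> = (\<integral>\<^sup>+ u. ennreal (Re (kober_kernel z a v u)) * indicator A u \<partial>sym_lebesgue)"
  proof (intro nn_integral_cong)
    fix u :: "real^'p::{finite,linorder}^'p::{finite,linorder}"
    show "?b (W ** matrix_inv u ** W) * indicator A (inv_sandwich v (W ** matrix_inv u ** W))
        * ennreal ((det W / det u) ^ (CARD('p) + 1)) * indicator ?P u
      = ennreal (Re (kober_kernel z a v u)) * indicator A u"
    proof (cases "posdef u")
      case True
      let ?x = "W ** matrix_inv u ** W" and ?J = "(det W / det u) ^ (CARD('p) + 1)"
      have x: "posdef ?x" by (rule posdef_inversion[OF W True])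
      have "inv_sandwich v ?x = u"
        using v x inversion_involution[OF posdef_det_nz[OF W] posdef_det_nz[OF True]]
        by (simp add: inv_sandwich_def W_def[symmetric])
      moreover have "Re (kober_kernel z a v u) = Re (beta1_density z a ?x) * ?J"
        using beta1_density_inversion[OF v True, of z a, folded W_def] b[of ?x]
        by (metis Re_complex_of_real of_real_mult)
      moreover have "ennreal (Re (beta1_density z a ?x) * ?J) = ?b ?x * ennreal ?J"
        using b[of ?x] by (intro ennreal_mult') blast
      ultimately show ?thesis using True by (simp only: mult_ac) (simp add: mult_ac)
    next
      case False
      then have "\<not> mat_less v u" using mat_less_posdef v by blast
      then show ?thesis using False by (simp add: kober_kernel_def)
    qed
  qed
  also have "\<dots> = emeasure ?R A" by (subst emeasure_density) auto
  finally show "emeasure ?L A = emeasure ?R A" .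
qed simp

subsection \<open>Finite products\<close>

lemma PiM_density:
  assumes I: "finite I"
    and sf: "\<And>i. i \<in> I \<Longrightarrow> sigma_finite_measure (M i)" "\<And>i. i \<in> I \<Longrightarrow> sigma_finite_measure (density (M i) (f i))"
    and f: "\<And>i. i \<in> I \<Longrightarrow> f i \<in> borel_measurable (M i)"
  shows "PiM I (\<lambda>i. density (M i) (f i)) = density (PiM I M) (\<lambda>x. \<Prod>i\<in>I. f i (x i))"
proof -
  \<comment> \<open>Outside \<open>I\<close> the measures are replaced by the one on the empty
    space, because \<open>product_sigma_finite\<close> speaks of every index.\<close>
  define M' where "M' = (\<lambda>i. if i \<in> I then M i else count_space {})"
  define D where "D = (\<lambda>i. if i \<in> I then density (M i) (f i) else count_space {})"
  interpret M': product_sigma_finite M'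
  proof (rule product_sigma_finite.intro)
    show "sigma_finite_measure (M' i)" for i
      by (cases "i \<in> I") (simp_all add: M'_def sf sigma_finite_measure_count_space_finite)
  qed
  interpret D: product_sigma_finite D
  proof (rule product_sigma_finite.intro)
    show "sigma_finite_measure (D i)" for i
      by (cases "i \<in> I") (simp_all add: D_def sf sigma_finite_measure_count_space_finite)
  qed
  have PM: "PiM I M = PiM I M'" and PD: "PiM I (\<lambda>i. density (M i) (f i)) = PiM I D"
    by (auto simp: M'_def D_def intro: PiM_cong)
  have f': "f i \<in> borel_measurable (M' i)" if "i \<in> I" for i using f that by (simp add: M'_def)
  have prod [measurable]: "(\<lambda>x. \<Prod>i\<in>I. f i (x i)) \<in> borel_measurable (PiM I M')"
    using f' by (intro borel_measurable_prod_ennreal) (metis measurable_compose measurable_component_singleton)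
  show ?thesis
    unfolding PM PD
  proof (rule D.PiM_eqI[OF I, symmetric])
    show "sets (density (PiM I M') (\<lambda>x. \<Prod>i\<in>I. f i (x i))) = sets (PiM I D)"
      by (auto simp: M'_def D_def intro!: sets_PiM_cong)
    fix A assume A: "\<And>i. i \<in> I \<Longrightarrow> A i \<in> sets (D i)"
    then have A': "A i \<in> sets (M' i)" if "i \<in> I" for i using that by (auto simp: M'_def D_def dest: A)
    have "emeasure (density (PiM I M') (\<lambda>x. \<Prod>i\<in>I. f i (x i))) (Pi\<^sub>E I A)
        = (\<integral>\<^sup>+ x. (\<Prod>i\<in>I. f i (x i)) * indicator (Pi\<^sub>E I A) x \<partial>PiM I M')"
      using A' I by (intro emeasure_density prod sets_PiM_I_finite)
    also have "\<dots> = (\<integral>\<^sup>+ x. (\<Prod>i\<in>I. f i (x i) * indicator (A i) (x i)) \<partial>PiM I M')"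
    proof (intro nn_integral_cong)
      fix x assume "x \<in> space (PiM I M')"
      then have "indicator (Pi\<^sub>E I A) x = (\<Prod>i\<in>I. indicator (A i) (x i) :: ennreal)"
        using I by (auto simp: space_PiM PiE_iff indicator_def prod.If_cases split: if_splits)
      then show "(\<Prod>i\<in>I. f i (x i)) * indicator (Pi\<^sub>E I A) x = (\<Prod>i\<in>I. f i (x i) * indicator (A i) (x i))"
        by (simp add: prod.distrib)
    qed
    also have "\<dots> = (\<Prod>i\<in>I. \<integral>\<^sup>+ x. f i x * indicator (A i) x \<partial>M' i)"
      using f' A' by (intro M'.product_nn_integral_prod I) auto
    also have "\<dots> = (\<Prod>i\<in>I. emeasure (D i) (A i))"
      using A' f' by (intro prod.cong refl) (auto simp: D_def M'_def emeasure_density)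
    finally show "emeasure (density (PiM I M') (\<lambda>x. \<Prod>i\<in>I. f i (x i))) (Pi\<^sub>E I A) = (\<Prod>i\<in>I. emeasure (D i) (A i))" .
  qed
qed

text \<open>For fixed \<open>v\<close> this pushes the joint beta law through all \<open>k\<close>
  substitutions at once.\<close>

lemma distr_PiM_componentwise:
  assumes I: "finite I"
    and P: "\<And>i. i \<in> I \<Longrightarrow> prob_space (M i)"
    and g: "\<And>i. i \<in> I \<Longrightarrow> g i \<in> M i \<rightarrow>\<^sub>M N i"
  shows "distr (PiM I M) (PiM I N) (\<lambda>x. \<lambda>i\<in>I. g i (x i)) = PiM I (\<lambda>i. distr (M i) (N i) (g i))"
proof -
  define M' where "M' = (\<lambda>i. if i \<in> I then M i else count_space {})"
  define D where "D = (\<lambda>i. if i \<in> I then distr (M i) (N i) (g i) else count_space {})"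
  have sf: "sigma_finite_measure (M i)" "sigma_finite_measure (distr (M i) (N i) (g i))" if "i \<in> I" for i
    using P[OF that] g[OF that] by (auto intro: prob_space_imp_sigma_finite prob_space.prob_space_distr)
  interpret M': product_sigma_finite M'
  proof (rule product_sigma_finite.intro)
    show "sigma_finite_measure (M' i)" for i
      by (cases "i \<in> I") (simp_all add: M'_def sf sigma_finite_measure_count_space_finite)
  qed
  interpret D: product_sigma_finite D
  proof (rule product_sigma_finite.intro)
    show "sigma_finite_measure (D i)" for i
      by (cases "i \<in> I") (simp_all add: D_def sf sigma_finite_measure_count_space_finite)
  qed
  have PM: "PiM I M = PiM I M'" and PD: "PiM I (\<lambda>i. distr (M i) (N i) (g i)) = PiM I D"
    by (auto simp: M'_def D_def intro: PiM_cong)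
  have g': "g i \<in> M' i \<rightarrow>\<^sub>M N i" if "i \<in> I" for i using g that by (simp add: M'_def)
  have G: "(\<lambda>x. \<lambda>i\<in>I. g i (x i)) \<in> PiM I M' \<rightarrow>\<^sub>M PiM I N"
    using g' by (intro measurable_restrict) (metis measurable_compose measurable_component_singleton)
  show ?thesis
    unfolding PM PD
  proof (rule D.PiM_eqI[OF I])
    show "sets (distr (PiM I M') (PiM I N) (\<lambda>x. \<lambda>i\<in>I. g i (x i))) = sets (PiM I D)"
      by (auto simp: D_def intro!: sets_PiM_cong)
    fix A assume "\<And>i. i \<in> I \<Longrightarrow> A i \<in> sets (D i)"
    then have A: "A i \<in> sets (N i)" if "i \<in> I" for i using that by (simp add: D_def)
    have "(\<lambda>x. \<lambda>i\<in>I. g i (x i)) -` Pi\<^sub>E I A \<inter> space (PiM I M') = Pi\<^sub>E I (\<lambda>i. g i -` A i \<inter> space (M' i))"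
      by (auto simp: space_PiM PiE_iff)
    then have "emeasure (distr (PiM I M') (PiM I N) (\<lambda>x. \<lambda>i\<in>I. g i (x i))) (Pi\<^sub>E I A)
        = emeasure (PiM I M') (Pi\<^sub>E I (\<lambda>i. g i -` A i \<inter> space (M' i)))"
      using A I by (subst emeasure_distr[OF G]) (auto intro: sets_PiM_I_finite)
    also have "\<dots> = (\<Prod>i\<in>I. emeasure (M' i) (g i -` A i \<inter> space (M' i)))"
      using A g' by (intro M'.emeasure_PiM I) (auto intro: measurable_sets)
    also have "\<dots> = (\<Prod>i\<in>I. emeasure (D i) (A i))"
      using A g' by (intro prod.cong refl) (auto simp: D_def M'_def emeasure_distr)
    finally show "emeasure (distr (PiM I M') (PiM I N) (\<lambda>x. \<lambda>i\<in>I. g i (x i))) (Pi\<^sub>E I A) = (\<Prod>i\<in>I. emeasure (D i) (A i))" .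
  qed
qed

section \<open>The joint law of the transformed matrices\<close>

lemma borel_measurable_Re_kober_kernel:
  fixes f g :: "'a \<Rightarrow> real^'p::{finite,linorder}^'p::{finite,linorder}"
  assumes [measurable]: "f \<in> borel_measurable M" "g \<in> borel_measurable M"
  shows "(\<lambda>x. Re (kober_kernel z a (f x) (g x))) \<in> borel_measurable M"
  by measurable

text \<open>Independence makes the joint law of the two tuples a product, so conditioning becomes an
  inner integral over the \<open>X j\<close> with \<open>v\<close> held fixed. Joint measurability
  is part of the conclusion because sections at a fixed \<open>u\<close> are integrated
  later.\<close>

lemma (in prob_space) distributed_inversion:
  fixes k :: nat and z a :: "nat \<Rightarrow> complex"
    and X V U :: "nat \<Rightarrow> 'a \<Rightarrow> real^'p::{finite,linorder}^'p::{finite,linorder}"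
    and f :: "(nat \<Rightarrow> real^'p::{finite,linorder}^'p::{finite,linorder}) \<Rightarrow> real"
  defines "S \<equiv> PiM {..<k} (\<lambda>_. sym_lebesgue)"
  assumes k: "k \<ge> 1"
    and beta: "\<And>j x. j < k \<Longrightarrow> beta1_density (z j) (a j) (x :: real^'p::{finite,linorder}^'p::{finite,linorder})
       = of_real (Re (beta1_density (z j) (a j) x)) \<and> Re (beta1_density (z j) (a j) x) \<ge> 0"
    and X: "\<And>j. j < k \<Longrightarrow> distributed M sym_lebesgue (X j) (\<lambda>x. ennreal (Re (beta1_density (z j) (a j) x)))"
    and indep_X: "indep_vars (\<lambda>_. borel) X {..<k}"
    and posdef_V: "AE \<omega> in M. \<forall>j<k. posdef (V j \<omega>)"
    and f: "\<And>v. f v \<ge> 0"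
    and V: "distributed M S (\<lambda>\<omega>. \<lambda>j\<in>{..<k}. V j \<omega>) (\<lambda>v. ennreal (f v))"
    and indep: "indep_var (PiM {..<k} (\<lambda>_. borel)) (\<lambda>\<omega>. \<lambda>j\<in>{..<k}. X j \<omega>)
           (PiM {..<k} (\<lambda>_. borel)) (\<lambda>\<omega>. \<lambda>j\<in>{..<k}. V j \<omega>)"
    and U: "\<And>j \<omega>. j < k \<Longrightarrow> U j \<omega> = msqrt (V j \<omega>) ** matrix_inv (X j \<omega>) ** msqrt (V j \<omega>)"
    and U_meas: "(\<lambda>\<omega>. \<lambda>j\<in>{..<k}. U j \<omega>) \<in> M \<rightarrow>\<^sub>M S"
  shows "distributed M S (\<lambda>\<omega>. \<lambda>j\<in>{..<k}. U j \<omega>)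
    (\<lambda>u. \<integral>\<^sup>+ v. ennreal (f v * (\<Prod>j<k. Re (kober_kernel (z j) (a j) (v j) (u j)))) \<partial>S)"
    and "case_prod (\<lambda>v u. f v * (\<Prod>j<k. Re (kober_kernel (z j) (a j) (v j) (u j)))) \<in> borel_measurable (S \<Otimes>\<^sub>M S)"
proof -
  define B where "B = PiM {..<k} (\<lambda>_. borel :: (real^'p::{finite,linorder}^'p::{finite,linorder}) measure)"
  define XX where "XX = (\<lambda>\<omega>. \<lambda>j\<in>{..<k}. X j \<omega>)"
  define VV where "VV = (\<lambda>\<omega>. \<lambda>j\<in>{..<k}. V j \<omega>)"
  define UU where "UU = (\<lambda>\<omega>. \<lambda>j\<in>{..<k}. U j \<omega>)"
  define T where "T = (\<lambda>(x, v). \<lambda>j\<in>{..<k}. inv_sandwich (v j) (x j :: real^'p::{finite,linorder}^'p::{finite,linorder}))"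
  define K where "K = (\<lambda>v u. \<Prod>j<k. Re (kober_kernel (z j) (a j) (v j) (u j :: real^'p::{finite,linorder}^'p::{finite,linorder})))"
  define b where "b = (\<lambda>j x. ennreal (Re (beta1_density (z j) (a j) (x :: real^'p::{finite,linorder}^'p::{finite,linorder}))))"
  \<comment> \<open>Independence is stated over \<open>borel\<close> and densities over
    \<open>sym_lebesgue\<close>; measurability passes between the two through this equality.\<close>
  have sets_BS [measurable_cong]: "sets B = sets S"
    unfolding B_def S_def by (intro sets_PiM_cong) simp_all
  interpret S: sigma_finite_measure S
  proof -
    have "product_sigma_finite (\<lambda>_ :: nat. sym_lebesgue :: (real^'p::{finite,linorder}^'p::{finite,linorder}) measure)"
      by (intro product_sigma_finite.intro sigma_finite_sym_lebesgue)
    then show "sigma_finite_measure S"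
      unfolding S_def by (rule product_sigma_finite.sigma_finite) simp
  qed
  interpret SS: pair_sigma_finite S S ..
  have comp_B: "(\<lambda>x. x j) \<in> borel_measurable B" if "j < k" for j
    unfolding B_def using that by (intro measurable_component_singleton) simp
  have comp_S: "(\<lambda>x. x j) \<in> borel_measurable S" if "j < k" for j
    using comp_B[OF that] by measurable
  have K_meas: "case_prod K \<in> borel_measurable (S \<Otimes>\<^sub>M S)"
    unfolding K_def case_prod_unfold
    by (intro borel_measurable_prod borel_measurable_Re_kober_kernel)
       (auto intro!: measurable_compose[OF measurable_fst] measurable_compose[OF measurable_snd] comp_S)
  have f_meas: "f \<in> borel_measurable S"
    using V f by (intro distributed_real_measurable[of S f M]) auto
  have "case_prod (\<lambda>v u. f v * K v u) \<in> borel_measurable (S \<Otimes>\<^sub>M S)"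
    using K_meas f_meas by measurable
  then show fK_meas: "case_prod (\<lambda>v u. f v * (\<Prod>j<k. Re (kober_kernel (z j) (a j) (v j) (u j)))) \<in> borel_measurable (S \<Otimes>\<^sub>M S)"
    by (simp add: K_def)
  have T_meas: "T \<in> B \<Otimes>\<^sub>M B \<rightarrow>\<^sub>M S"
    unfolding T_def S_def case_prod_unfold
  proof (intro measurable_restrict)
    fix j assume "j \<in> {..<k}"
    then have "(\<lambda>w. inv_sandwich (snd w j) (fst w j)) \<in> borel_measurable (B \<Otimes>\<^sub>M B)"
      by (intro borel_measurable_inv_sandwich)
         (auto intro!: measurable_compose[OF measurable_fst] measurable_compose[OF measurable_snd] comp_B)
    then show "(\<lambda>w. inv_sandwich (snd w j) (fst w j)) \<in> (B \<Otimes>\<^sub>M B) \<rightarrow>\<^sub>M sym_lebesgue"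
      by (simp cong: measurable_cong_sets)
  qed
  have XX: "XX \<in> M \<rightarrow>\<^sub>M B" and VV: "VV \<in> M \<rightarrow>\<^sub>M B" and UU: "UU \<in> M \<rightarrow>\<^sub>M S"
    using indep U_meas by (simp_all add: XX_def VV_def B_def UU_def indep_var_distribution_eq)
  have XV: "distr M (B \<Otimes>\<^sub>M B) (\<lambda>\<omega>. (XX \<omega>, VV \<omega>)) = distr M B XX \<Otimes>\<^sub>M distr M B VV"
    using indep by (simp add: XX_def VV_def B_def indep_var_distribution_eq)
  have X_distr: "distr M borel (X j) = density sym_lebesgue (b j)" if "j < k" for j
    using distributed_distr_eq_density[OF X[OF that]] unfolding b_def
    by (subst distr_cong[of M M borel sym_lebesgue "X j" "X j"]) simp_all
  have X_meas: "X j \<in> borel_measurable M" if "j < k" for j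
    using distributed_measurable[OF X[OF that]] by (simp cong: measurable_cong_sets)
  have XX_distr: "distr M B XX = PiM {..<k} (\<lambda>j. density sym_lebesgue (b j))"
  proof -
    have "distr M B XX = PiM {..<k} (\<lambda>j. distr M borel (X j))"
    proof -
      \<comment> \<open>The product form of mutual independence is applied to a nonempty index set;
        here \<open>k \<ge> 1\<close> enters.\<close>
      have ne: "{..<k} \<noteq> {}" using k by (auto simp: lessThan_empty_iff)
      show ?thesis
        unfolding B_def XX_def
        using indep_vars_iff_distr_eq_PiM'[OF ne, where X = X and M' = "\<lambda>_. borel"] X_meas indep_X by simp
    qed
    also have "\<dots> = PiM {..<k} (\<lambda>j. density sym_lebesgue (b j))"
      by (rule PiM_cong) (simp_all add: X_distr)
    finally show ?thesis .
  qed
  have VV_distr: "distr M B VV = density S (\<lambda>v. ennreal (f v))"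
    using distributed_distr_eq_density[OF V] unfolding VV_def
    by (subst distr_cong[OF refl sets_BS refl])
  have "AE \<omega> in M. \<forall>j<k. posdef (X j \<omega>)"
  proof -
    have "AE \<omega> in M. posdef (X j \<omega>)" if j: "j < k" for j
    proof -
      have "AE x in density sym_lebesgue (b j). posdef x"
      proof (subst AE_density)
        show "b j \<in> borel_measurable sym_lebesgue" unfolding b_def by measurable
        have "b j x = 0" if "\<not> posdef x" for x
          using that by (simp add: b_def beta1_density_def Let_def)
        then show "AE x in sym_lebesgue. 0 < b j x \<longrightarrow> posdef x"
          by (intro AE_I2) force
      qed
      then have "AE x in distr M borel (X j). posdef x" unfolding X_distr[OF j] .
      then show ?thesis by (rule AE_distrD[OF X_meas[OF j]])
    qed
    then have "AE \<omega> in M. \<forall>j\<in>{..<k}. posdef (X j \<omega>)"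
      by (intro AE_finite_allI) auto
    then show ?thesis by (rule AE_mp) (auto intro!: AE_I2)
  qed
  \<comment> \<open>\<open>T\<close> is built from the guarded map, which is tied to the definition
    of \<open>U\<close> only on the cone.\<close>
  with posdef_V have UU_eq: "AE \<omega> in M. UU \<omega> = T (XX \<omega>, VV \<omega>)"
  proof eventually_elim
    case (elim \<omega>)
    then show ?case
      by (auto simp: UU_def T_def XX_def VV_def U inv_sandwich_def restrict_def fun_eq_iff)
  qed
  \<comment> \<open>The conditional law is known only at positive definite \<open>v\<close>;
    elsewhere \<open>f\<close> vanishes almost everywhere because the \<open>V j\<close> lie in the
    cone.\<close>
  have posdef_f: "AE v in S. 0 < ennreal (f v) \<longrightarrow> (\<forall>j<k. posdef (v j))"
  proof -
    have meas: "{v \<in> space B. \<forall>j\<in>{..<k}. posdef (v j)} \<in> sets B"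
      using measurable_compose[OF comp_B measurable_posdef]
      by (intro sets.sets_Collect_finite_All) (auto simp: pred_def)
    have "AE \<omega> in M. \<forall>j\<in>{..<k}. posdef (VV \<omega> j)"
      using posdef_V by (rule AE_mp) (auto intro!: AE_I2 simp: VV_def)
    then have "AE v in distr M B VV. \<forall>j\<in>{..<k}. posdef (v j)"
      by (subst AE_distr_iff[OF VV meas])
    then show ?thesis
      using f_meas unfolding VV_distr by (subst (asm) AE_density) auto
  qed
  \<comment> \<open>The law of the \<open>U j\<close> for fixed \<open>v\<close>: the coordinates
    stay independent, so the densities multiply to \<open>K v\<close>.\<close>
  have inner: "(\<integral>\<^sup>+ x. indicator A (T (x, v)) \<partial>distr M B XX) = (\<integral>\<^sup>+ u. ennreal (K v u) * indicator A u \<partial>S)"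
    if A: "A \<in> sets S" and v: "\<And>j. j < k \<Longrightarrow> posdef (v j)" for A v
  proof -
    let ?D = "\<lambda>j. density sym_lebesgue (b j)"
    let ?k = "\<lambda>j u. ennreal (Re (kober_kernel (z j) (a j) (v j) u))"
    have is_meas: "inv_sandwich (v j) \<in> ?D j \<rightarrow>\<^sub>M sym_lebesgue" for j
    proof -
      have eq: "measurable (?D j) sym_lebesgue = measurable borel (borel :: (real^'p::{finite,linorder}^'p::{finite,linorder}) measure)"
        by (intro measurable_cong_sets) simp_all
      show ?thesis unfolding eq by measurable
    qed
    have probD: "prob_space (?D j)" if "j < k" for j
      using prob_space_distr[OF X_meas[OF that]] unfolding X_distr[OF that] .
    have distr_D: "distr (?D j) sym_lebesgue (inv_sandwich (v j)) = density sym_lebesgue (?k j)" if "j < k" for j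
      unfolding b_def by (rule distr_inv_sandwich[OF beta v]) (use that in auto)
    have Tx: "(\<lambda>x. T (x, v)) = (\<lambda>x. \<lambda>j\<in>{..<k}. inv_sandwich (v j) (x j))" by (simp add: T_def)
    then have "distr (distr M B XX) S (\<lambda>x. T (x, v)) = PiM {..<k} (\<lambda>j. distr (?D j) sym_lebesgue (inv_sandwich (v j)))"
      unfolding XX_distr S_def by (simp only:) (rule distr_PiM_componentwise, auto intro: probD is_meas)
    also have "\<dots> = PiM {..<k} (\<lambda>j. density sym_lebesgue (?k j))"
      by (rule PiM_cong[OF refl]) (simp only: distr_D lessThan_iff)
    also have "\<dots> = density S (\<lambda>u. \<Prod>j\<in>{..<k}. ?k j (u j))"
      unfolding S_def
    proof (rule PiM_density)
      fix j assume "j \<in> {..<k}"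
      then have j: "j < k" by simp
      have "prob_space (density sym_lebesgue (?k j))"
        using prob_space.prob_space_distr[OF probD[OF j] is_meas] unfolding distr_D[OF j] .
      then show "sigma_finite_measure (density sym_lebesgue (?k j))" by (rule prob_space_imp_sigma_finite)
      show "?k j \<in> borel_measurable sym_lebesgue" by simp
    qed (simp_all add: sigma_finite_sym_lebesgue)
    also have "(\<lambda>u. \<Prod>j\<in>{..<k}. ?k j (u j)) = (\<lambda>u. ennreal (K v u))"
      using kober_kernel_nonneg(2)[OF beta] unfolding K_def by (intro ext prod_ennreal) auto
    finally have eq: "distr (distr M B XX) S (\<lambda>x. T (x, v)) = density S (\<lambda>u. ennreal (K v u))" .
    have Tv: "(\<lambda>x. T (x, v)) \<in> distr M B XX \<rightarrow>\<^sub>M S"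
    proof -
      have eqm: "measurable (distr M B XX) S = measurable B S" by (intro measurable_cong_sets) simp_all
      have sm: "measurable B (sym_lebesgue :: (real^'p::{finite,linorder}^'p::{finite,linorder}) measure) = borel_measurable B"
        by (intro measurable_cong_sets) simp_all
      show ?thesis
        unfolding eqm unfolding Tx S_def
        by (intro measurable_restrict, unfold sm) (intro borel_measurable_inv_sandwich comp_B, simp_all)
    qed
    have Kv: "K v \<in> borel_measurable S"
      unfolding K_def using comp_S by (intro borel_measurable_prod borel_measurable_Re_kober_kernel) auto
    have "(\<integral>\<^sup>+ x. indicator A (T (x, v)) \<partial>distr M B XX) = (\<integral>\<^sup>+ u. indicator A u \<partial>density S (\<lambda>u. ennreal (K v u)))"
      unfolding eq[symmetric] using A by (intro nn_integral_distr[symmetric] Tv) simp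
    also have "\<dots> = (\<integral>\<^sup>+ u. ennreal (K v u) * indicator A u \<partial>S)"
      using A Kv by (intro nn_integral_density) auto
    finally show ?thesis .
  qed
  have "distr M S UU = density S (\<lambda>u. \<integral>\<^sup>+ v. ennreal (f v * K v u) \<partial>S)"
  proof (rule measure_eqI)
    fix A assume "A \<in> sets (distr M S UU)"
    then have A [measurable]: "A \<in> sets S" by simp
    note [measurable] = K_meas f_meas
    interpret DX: prob_space "distr M B XX" by (rule prob_space_distr[OF XX])
    interpret DV: prob_space "distr M B VV" by (rule prob_space_distr[OF VV])
    interpret D: pair_sigma_finite "distr M B XX" "distr M B VV" ..
    have iT: "(\<lambda>w. indicator A (T w) :: ennreal) \<in> borel_measurable (B \<Otimes>\<^sub>M B)"
      using T_meas A by measurable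
    have iT': "(\<lambda>w. indicator A (T w) :: ennreal) \<in> borel_measurable (distr M B XX \<Otimes>\<^sub>M distr M B VV)"
      using iT by (simp cong: measurable_cong_sets sets_pair_measure_cong)
    have "(\<lambda>v. \<integral>\<^sup>+ x. indicator A (T (x, v)) \<partial>distr M B XX) \<in> borel_measurable (distr M B VV)"
      by (rule DX.borel_measurable_nn_integral) (use iT' in measurable)
    then have inner_meas: "(\<lambda>v. \<integral>\<^sup>+ x. indicator A (T (x, v)) \<partial>distr M B XX) \<in> borel_measurable S"
      using sets_BS by (simp cong: measurable_cong_sets)
    have "emeasure (distr M S UU) A = (\<integral>\<^sup>+ \<omega>. indicator A (UU \<omega>) \<partial>M)"
    proof -
      have "emeasure (distr M S UU) A = (\<integral>\<^sup>+ u. indicator A u \<partial>distr M S UU)"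
        using A by (intro nn_integral_indicator[symmetric]) simp
      also have "\<dots> = (\<integral>\<^sup>+ \<omega>. indicator A (UU \<omega>) \<partial>M)"
        using A UU by (intro nn_integral_distr) simp_all
      finally show ?thesis .
    qed
    also have "\<dots> = (\<integral>\<^sup>+ \<omega>. indicator A (T (XX \<omega>, VV \<omega>)) \<partial>M)"
      using UU_eq by (intro nn_integral_cong_AE) auto
    also have "\<dots> = (\<integral>\<^sup>+ w. indicator A (T w) \<partial>(distr M B XX \<Otimes>\<^sub>M distr M B VV))"
      unfolding XV[symmetric]
      by (intro nn_integral_distr[symmetric] measurable_Pair XX VV) (simp add: iT)
    also have "\<dots> = (\<integral>\<^sup>+ v. \<integral>\<^sup>+ x. indicator A (T (x, v)) \<partial>distr M B XX \<partial>distr M B VV)"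
      by (rule D.nn_integral_snd[OF iT', symmetric])
    also have "\<dots> = (\<integral>\<^sup>+ v. ennreal (f v) * (\<integral>\<^sup>+ x. indicator A (T (x, v)) \<partial>distr M B XX) \<partial>S)"
      unfolding VV_distr using f_meas inner_meas by (intro nn_integral_density) auto
    also have "\<dots> = (\<integral>\<^sup>+ v. \<integral>\<^sup>+ u. ennreal (f v * K v u) * indicator A u \<partial>S \<partial>S)"
      using posdef_f
    proof (intro nn_integral_cong_AE, eventually_elim)
      case (elim v)
      have Kv: "(\<lambda>u. ennreal (K v u) * indicator A u) \<in> borel_measurable S"
        unfolding K_def using comp_S A
        by (intro borel_measurable_times_ennreal measurable_compose[OF _ measurable_ennreal] borel_measurable_prod
            borel_measurable_Re_kober_kernel) auto
      have "ennreal (f v) * (\<integral>\<^sup>+ x. indicator A (T (x, v)) \<partial>distr M B XX)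
          = ennreal (f v) * (\<integral>\<^sup>+ u. ennreal (K v u) * indicator A u \<partial>S)"
      proof (cases "0 < ennreal (f v)")
        case True
        then show ?thesis using elim inner[OF A, of v] by simp
      next
        case False
        then have "f v = 0" using f[of v] by simp
        then show ?thesis by simp
      qed
      also have "\<dots> = (\<integral>\<^sup>+ u. ennreal (f v * K v u) * indicator A u \<partial>S)"
        using f by (subst nn_integral_cmult[symmetric, OF Kv]) (simp add: ennreal_mult' mult_ac)
      finally show ?case .
    qed
    \<comment> \<open>Tonelli: with \<open>u\<close> outside, the inner integral over
      \<open>v\<close> is the density sought.\<close>
    also have "\<dots> = (\<integral>\<^sup>+ u. \<integral>\<^sup>+ v. ennreal (f v * K v u) * indicator A u \<partial>S \<partial>S)"
      by (rule SS.Fubini'[symmetric]) measurable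
    also have "\<dots> = (\<integral>\<^sup>+ u. (\<integral>\<^sup>+ v. ennreal (f v * K v u) \<partial>S) * indicator A u \<partial>S)"
      by (intro nn_integral_cong) (auto split: split_indicator)
    also have "\<dots> = emeasure (density S (\<lambda>u. \<integral>\<^sup>+ v. ennreal (f v * K v u) \<partial>S)) A"
      by (rule emeasure_density[symmetric]) measurable
    finally show "emeasure (distr M S UU) A = emeasure (density S (\<lambda>u. \<integral>\<^sup>+ v. ennreal (f v * K v u) \<partial>S)) A" .
  qed simp
  moreover have "(\<lambda>u. \<integral>\<^sup>+ v. ennreal (f v * K v u) \<partial>S) \<in> borel_measurable S"
    using K_meas f_meas by measurable
  ultimately show "distributed M S (\<lambda>\<omega>. \<lambda>j\<in>{..<k}. U j \<omega>)
    (\<lambda>u. \<integral>\<^sup>+ v. ennreal (f v * (\<Prod>j<k. Re (kober_kernel (z j) (a j) (v j) (u j)))) \<partial>S)"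
    using UU unfolding distributed_def UU_def K_def by simp
qed

section \<open>Identification with the Kober operator\<close>

text \<open>The prefactor cancels all of each beta constant except
  \<open>1 / mgamma CARD('p) (a j)\<close>. One index outside the domain annihilates the product of
  kernels, just as it does the indicator.\<close>

lemma prod_kober_kernel:
  fixes u v :: "nat \<Rightarrow> real^'p::{finite,linorder}^'p::{finite,linorder}"
  assumes nz: "\<And>j. j < k \<Longrightarrow> mgamma CARD('p) (z j) \<noteq> 0" "\<And>j. j < k \<Longrightarrow> mgamma CARD('p) (z j + a j) \<noteq> 0"
  shows "(\<Prod>j<k. mgamma CARD('p) (z j) / mgamma CARD('p) (z j + a j)) * (\<Prod>j<k. kober_kernel (z j) (a j) (v j) (u j))
    = (\<Prod>j<k. cpow (det (u j)) (- z j - a j) / mgamma CARD('p) (a j)) *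
      (indicator {v. \<forall>j<k. posdef (v j) \<and> mat_less (v j) (u j)} v *\<^sub>R
        (\<Prod>j<k. cpow (det (v j)) (z j) * cpow (det (u j - v j)) (a j - of_real ((real CARD('p) + 1) / 2))))"
proof (cases "\<forall>j<k. posdef (v j) \<and> mat_less (v j) (u j)")
  case True
  have "(\<Prod>j<k. mgamma CARD('p) (z j) / mgamma CARD('p) (z j + a j)) * (\<Prod>j<k. kober_kernel (z j) (a j) (v j) (u j))
    = (\<Prod>j<k. cpow (det (u j)) (- z j - a j) / mgamma CARD('p) (a j) *
       (cpow (det (v j)) (z j) * cpow (det (u j - v j)) (a j - of_real ((real CARD('p) + 1) / 2))))"
    unfolding prod.distrib[symmetric]
    by (intro prod.cong refl) (use True nz in \<open>simp add: kober_kernel_def\<close>)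
  also have "\<dots> = (\<Prod>j<k. cpow (det (u j)) (- z j - a j) / mgamma CARD('p) (a j)) *
       (\<Prod>j<k. cpow (det (v j)) (z j) * cpow (det (u j - v j)) (a j - of_real ((real CARD('p) + 1) / 2)))"
    by (rule prod.distrib)
  finally show ?thesis using True by (simp only: indicator_simps mem_Collect_eq scaleR_one simp_thms)
next
  case False
  then obtain j where "j < k" "\<not> (posdef (v j) \<and> mat_less (v j) (u j))" by blast
  then have "(\<Prod>j<k. kober_kernel (z j) (a j) (v j) (u j)) = 0"
    by (intro prod_zero) (auto simp: kober_kernel_def)
  then show ?thesis using False by simp
qed

theorem theorem3p1:
  fixes M :: "'w measure"
    and k :: nat
    and a z :: "nat \<Rightarrow> complex"
    and X V U :: "nat \<Rightarrow> 'w \<Rightarrow> real^'p::{finite,linorder}^'p::{finite,linorder}"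
    and f g :: "(nat \<Rightarrow> real^'p::{finite,linorder}^'p::{finite,linorder}) \<Rightarrow> real"
  assumes "prob_space M"
    and "k \<ge> 1"
    and "\<forall>j<k. Re (a j) > (real CARD('p) - 1) / 2"
    and "\<forall>j<k. Re (z j) > (real CARD('p) - 1) / 2"
    \<comment> \<open>X_j has the type-1 beta density\<close>
    and "\<forall>j<k. \<exists>d. distributed M sym_lebesgue (X j) (\<lambda>x. ennreal (d x)) \<and>
                   (AE x in sym_lebesgue. complex_of_real (d x) = beta1_density (z j) (a j) x)"
    \<comment> \<open>X_1, ..., X_k mutually independent\<close>
    and "prob_space.indep_vars M (\<lambda>_. borel) X {..<k}"
    \<comment> \<open>V_j positive definite, with joint density f\<close>
    and "AE \<omega> in M. \<forall>j<k. posdef (V j \<omega>)"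
    and "\<forall>v. f v \<ge> 0"
    and "distributed M (PiM {..<k} (\<lambda>_. sym_lebesgue)) (\<lambda>\<omega>. \<lambda>j\<in>{..<k}. V j \<omega>) (\<lambda>v. ennreal (f v))"
    \<comment> \<open>(X_1,...,X_k) and (V_1,...,V_k) independent\<close>
    and "prob_space.indep_var M
           (PiM {..<k} (\<lambda>_. borel)) (\<lambda>\<omega>. \<lambda>j\<in>{..<k}. X j \<omega>)
           (PiM {..<k} (\<lambda>_. borel)) (\<lambda>\<omega>. \<lambda>j\<in>{..<k}. V j \<omega>)"
    \<comment> \<open>X_j = V_j^(1/2) U_j^(-1) V_j^(1/2)\<close>
    and "\<forall>j<k. \<forall>\<omega>. U j \<omega> = msqrt (V j \<omega>) ** matrix_inv (X j \<omega>) ** msqrt (V j \<omega>)"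
    \<comment> \<open>g is the joint density of U_1, ..., U_k\<close>
    and "\<forall>u. g u \<ge> 0"
    and "distributed M (PiM {..<k} (\<lambda>_. sym_lebesgue)) (\<lambda>\<omega>. \<lambda>j\<in>{..<k}. U j \<omega>) (\<lambda>u. ennreal (g u))"
  shows "AE u in PiM {..<k} (\<lambda>_. sym_lebesgue).
           (\<Prod>j<k. mgamma CARD('p) (z j) / mgamma CARD('p) (z j + a j)) * complex_of_real (g u)
             = kober_I1 k z a f u"
proof -
  interpret prob_space M by fact
  define S where "S = PiM {..<k} (\<lambda>_. sym_lebesgue :: (real^'p::{finite,linorder}^'p::{finite,linorder}) measure)"
  define K where "K = (\<lambda>v u. \<Prod>j<k. Re (kober_kernel (z j) (a j) (v j) (u j :: real^'p::{finite,linorder}^'p::{finite,linorder})))"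
  have beta: "beta1_density (z j) (a j) (x :: real^'p::{finite,linorder}^'p::{finite,linorder})
      = of_real (Re (beta1_density (z j) (a j) x)) \<and> Re (beta1_density (z j) (a j) x) \<ge> 0" if "j < k" for j x
    using beta1_density_nonneg assms(3,4,5) that by blast
  have X: "distributed M sym_lebesgue (X j) (\<lambda>x. ennreal (Re (beta1_density (z j) (a j) x)))" if j: "j < k" for j
  proof -
    obtain d where d: "distributed M sym_lebesgue (X j) (\<lambda>x. ennreal (d x))"
      "AE x in sym_lebesgue. complex_of_real (d x) = beta1_density (z j) (a j) x"
      using assms(5) j by blast
    \<comment> \<open>The given density \<open>d\<close> is exchanged for the explicit one, with
      which it agrees almost everywhere.\<close>
    have "AE x in sym_lebesgue. ennreal (d x) = ennreal (Re (beta1_density (z j) (a j) x))"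
      using d(2) by eventually_elim (metis Re_complex_of_real)
    moreover have "(\<lambda>x :: real^'p::{finite,linorder}^'p::{finite,linorder}. ennreal (Re (beta1_density (z j) (a j) x))) \<in> borel_measurable sym_lebesgue"
      by measurable
    ultimately show ?thesis
      by (rule distributed_cong_density[OF _ _ distributed_borel_measurable[OF d(1)], THEN iffD1]) (rule d(1))
  qed
  have U_meas: "(\<lambda>\<omega>. \<lambda>j\<in>{..<k}. U j \<omega>) \<in> M \<rightarrow>\<^sub>M S"
    using distributed_measurable[OF assms(13)] by (simp add: S_def)
  note main = distributed_inversion[where z = z and a = a, OF assms(2) beta X assms(6,7) _ assms(9,10) _ U_meas[unfolded S_def], folded S_def]
  have U_distr: "distributed M S (\<lambda>\<omega>. \<lambda>j\<in>{..<k}. U j \<omega>) (\<lambda>u. \<integral>\<^sup>+ v. ennreal (f v * K v u) \<partial>S)"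
    unfolding K_def using assms(8,11) by (intro main(1)) auto
  have fK_meas: "case_prod (\<lambda>v u. f v * K v u) \<in> borel_measurable (S \<Otimes>\<^sub>M S)"
    unfolding K_def using assms(8,11) by (intro main(2)) auto
  have K_nonneg: "K v u \<ge> 0" and K_eq: "complex_of_real (K v u) = (\<Prod>j<k. kober_kernel (z j) (a j) (v j) (u j))" for v u
  proof -
    show "K v u \<ge> 0"
      unfolding K_def using kober_kernel_nonneg(2)[OF beta] by (intro prod_nonneg) auto
    show "complex_of_real (K v u) = (\<Prod>j<k. kober_kernel (z j) (a j) (v j) (u j))"
      unfolding K_def of_real_prod by (intro prod.cong refl) (metis kober_kernel_nonneg(1)[OF beta] lessThan_iff)
  qed
  have "AE u in S. ennreal (g u) = (\<integral>\<^sup>+ v. ennreal (f v * K v u) \<partial>S)"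
    using distributed_unique[OF assms(13)[folded S_def] U_distr] .
  then show ?thesis
    unfolding S_def[symmetric]
  proof (rule AE_mp, intro AE_I2 impI)
    fix u assume u: "u \<in> space S" and eq: "ennreal (g u) = (\<integral>\<^sup>+ v. ennreal (f v * K v u) \<partial>S)"
    have fK: "(\<lambda>v. f v * K v u) \<in> borel_measurable S"
      using measurable_compose[OF measurable_Pair2'[OF u] fK_meas] by simp
    \<comment> \<open>For these \<open>u\<close> the nonnegative integral is finite, being
      \<open>ennreal (g u)\<close>, so the passage to the real Bochner integral loses
      nothing.\<close>
    have "g u = enn2real (\<integral>\<^sup>+ v. ennreal (f v * K v u) \<partial>S)"
      using assms(12) by (metis enn2real_ennreal eq)
    also have "\<dots> = (LINT v|S. f v * K v u)"
      using assms(8) K_nonneg by (intro integral_eq_nn_integral[symmetric] fK) auto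
    finally have "complex_of_real (g u) = (LINT v|S. complex_of_real (f v * K v u))"
      by (simp only: integral_complex_of_real)
    then have "(\<Prod>j<k. mgamma CARD('p) (z j) / mgamma CARD('p) (z j + a j)) * complex_of_real (g u)
      = (LINT v|S. (\<Prod>j<k. mgamma CARD('p) (z j) / mgamma CARD('p) (z j + a j)) * complex_of_real (f v * K v u))"
      by (simp only: integral_mult_right_zero)
    also have "\<dots> = (LINT v|S. (\<Prod>j<k. cpow (det (u j)) (- z j - a j) / mgamma CARD('p) (a j)) *
        (indicator {v. \<forall>j<k. posdef (v j) \<and> mat_less (v j) (u j)} v *\<^sub>R
        ((\<Prod>j<k. cpow (det (v j)) (z j) * cpow (det (u j - v j)) (a j - of_real ((real CARD('p) + 1) / 2))) * complex_of_real (f v))))"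
    proof (intro Bochner_Integration.integral_cong refl)
      fix v :: "nat \<Rightarrow> real^'p::{finite,linorder}^'p::{finite,linorder}"
      have z_nz: "mgamma CARD('p) (z j) \<noteq> 0" if "j < k" for j
        using assms(4) that by (intro mgamma_nonzero) blast
      have za_nz: "mgamma CARD('p) (z j + a j) \<noteq> 0" if "j < k" for j
        using assms(3,4) that by (intro mgamma_add_nonzero) (simp_all add: Suc_leI)
      let ?c = "\<Prod>j<k. mgamma CARD('p) (z j) / mgamma CARD('p) (z j + a j)"
      let ?A = "\<Prod>j<k. cpow (det (u j)) (- z j - a j) / mgamma CARD('p) (a j)"
      let ?B = "\<Prod>j<k. cpow (det (v j)) (z j) * cpow (det (u j - v j)) (a j - of_real ((real CARD('p) + 1) / 2))"
      let ?i = "indicator {v. \<forall>j<k. posdef (v j) \<and> mat_less (v j) (u j)} v :: real"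
      have kern: "?c * (\<Prod>j<k. kober_kernel (z j) (a j) (v j) (u j)) = ?A * (?i *\<^sub>R ?B)"
        by (intro prod_kober_kernel z_nz za_nz)
      have "?c * complex_of_real (f v * K v u)
          = ?c * (\<Prod>j<k. kober_kernel (z j) (a j) (v j) (u j)) * complex_of_real (f v)"
        by (simp only: of_real_mult K_eq mult_ac)
      also have "\<dots> = ?A * (?i *\<^sub>R ?B) * complex_of_real (f v)"
        by (simp only: kern)
      also have "\<dots> = ?A * (?i *\<^sub>R (?B * complex_of_real (f v)))"
        by (simp only: mult.assoc mult_scaleR_left)
      finally show "?c * complex_of_real (f v * K v u) = ?A * (?i *\<^sub>R (?B * complex_of_real (f v)))" .
    qed
    also have "\<dots> = kober_I1 k z a f u"
      unfolding kober_I1_def Let_def set_lebesgue_integral_def S_def[symmetric]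
      by (simp only: integral_mult_right_zero)
    finally show "(\<Prod>j<k. mgamma CARD('p) (z j) / mgamma CARD('p) (z j + a j)) * complex_of_real (g u)
      = kober_I1 k z a f u" .
  qed
qed

end
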